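(* Let $(E,\mathcal L,\mathcal B)$ be a normal labelled space and $K$ a field. Then $L_K(E,\mathcal L,\mathcal B)$ is semiprime.
   Context: Graphs and labels. A directed graph $E=(E^0,E^1,r,s)$ has a nonempty vertex set $E^0$, an edge set $E^1$, and range and source maps $r,s:E^1\to E^0$. A path of length $n\ge1$ is a sequence $\lambda=\lambda_1\cdots\lambda_n$ of edges with $r(\lambda_i)=s(\lambda_{i+1})$; its source is $s(\lambda_1)$ and its range is $r(\lambda_n)$; $E^n$ is the set of paths of length $n$. A labelled graph $(E,\mathcal L)$ is a directed graph with a surjective map $\mathcal L:E^1\to\mathcal A$ onto a nonempty set $\mathcal A$ (the alphabet), extended to paths by $\mathcal L(\lambda_1\cdots\lambda_n)=\mathcal L(\lambda_1)\cdots\mathcal L(\lambda_n)$. Put $\mathcal L^n=\mathcal L(E^n)$ for $n\geq 1$, $\mathcal L^{\ge1}=\bigcup_{n\ge1}\mathcal L^n$ and $\mathcal L^*=\mathcal L^{\ge1}\cup\{\omega\}$, with $\omega$ the empty word. For $A\subseteq E^0$ and $\alpha\in\mathcal L^{\ge1}$, $r(A,\alpha)=\{r(\lambda)\mid \lambda \text{ a path},\ \mathcal L(\lambda)=\alpha,\ s(\lambda)\in A\}$; $r(A,\omega)=A$; $r(\alpha)=r(E^0,\alpha)$; $\mathcal L(AE^1)=\{\mathcal L(e)\mid e\in E^1,\ s(e)\in A\}$. Labelled spaces. A labelled space $(E,\mathcal L,\mathcal B)$ is a labelled graph with a family $\mathcal B$ of subsets of $E^0$ closed under finite intersections and finite unions,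 containing $r(\alpha)$ for all $\alpha\in\mathcal L^{\ge1}$, and such that $r(A,\alpha)\in\mathcal B$ for all $A\in\mathcal B$, $\alpha\in\mathcal L^*$. It is normal if it is weakly left-resolving, i.e. $r(A\cap B,\alpha)=r(A,\alpha)\cap r(B,\alpha)$ for all $A,B\in\mathcal B$, $\alpha\in\mathcal L^{\ge1}$, and $\mathcal B$ is closed under relative complements. A nonempty $A\in\mathcal B$ is regular if $0<|\mathcal L(BE^1)|<\infty$ for every nonempty $B\in\mathcal B$ with $B\subseteq A$; $\mathcal B_{\mathrm{reg}}$ is the set of regular elements together with $\emptyset$. The algebra. $L_K(E,\mathcal L,\mathcal B)$ (Leavitt labelled path algebra) is the universal (associative, not necessarily unital) $K$-algebra with generators $\{p_A\mid A\in\mathcal B\}$ and $\{s_a,s_a^*\mid a\in\mathcal A\}$ and relations: (i) $p_{A\cap B}=p_Ap_B$, $p_{A\cup B}=p_A+p_B-p_{A\cap B}$, $p_\emptyset=0$ for $A,B\in\mathcal B$; (ii) $p_As_a=s_ap_{r(A,a)}$ and $s_a^*p_A=p_{r(A,a)}s_a^*$ for $A\in\mathcal B$, $a\in\mathcal A$; (iii) $s_a^*s_a=p_{r(a)}$, and $s_b^*s_a=0$ if $b\ne a$; (iv) $s_as_a^*s_a=s_a$ and $s_a^*s_as_a^*=s_a^*$; (v) $p_A=\sum_{a\in\mathcal L(AE^1)}s_ap_{r(A,a)}s_a^*$ for every $A\in\mathcal B_{\mathrm{reg}}$. A ring $R$ is semiprime if, for every (two-sided) ideal $I$ of $R$, $I^2=0$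 implies $I=0$. *)

theory Defs
  imports
    "HOL-Algebra.QuotRing"
    "HOL-Algebra.Module"
    "HOL-Algebra.Ideal_Product"
    "HOL-Library.Poly_Mapping"
    "Graph_Theory.Arc_Walk"
begin

section \<open>Labelled spaces\<close>

text \<open>
  A directed graph is a \<^locale>\<open>wf_digraph\<close>, possibly infinite; \<^const>\<open>tail\<close> is the source map and
  \<^const>\<open>head\<close> the range map. The alphabet is the set of labels that occur, so that the labelling is
  onto by construction, and label words are lists, with \<open>[]\<close> for the empty word.
\<close>

definition alphabet :: "('v, 'e) pre_digraph \<Rightarrow> ('e \<Rightarrow> 'a) \<Rightarrow> 'a set" where
  "alphabet E lab = lab ` arcs E"

definition path_labels :: "('v, 'e) pre_digraph \<Rightarrow> ('e \<Rightarrow> 'a) \<Rightarrow> nat \<Rightarrow> 'a list set" where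
  "path_labels E lab n = {map lab p | u p v. pre_digraph.awalk E u p v \<and> length p = n}"

definition label_words1 :: "('v, 'e) pre_digraph \<Rightarrow> ('e \<Rightarrow> 'a) \<Rightarrow> 'a list set" where
  "label_words1 E lab = (\<Union>n\<in>{1..}. path_labels E lab n)"

definition label_words :: "('v, 'e) pre_digraph \<Rightarrow> ('e \<Rightarrow> 'a) \<Rightarrow> 'a list set" where
  "label_words E lab = insert [] (label_words1 E lab)"

definition rel_range :: "('v, 'e) pre_digraph \<Rightarrow> ('e \<Rightarrow> 'a) \<Rightarrow> 'v set \<Rightarrow> 'a list \<Rightarrow> 'v set" where
  "rel_range E lab A \<alpha> =
    (if \<alpha> = [] then A
     else {v. \<exists>u p. pre_digraph.awalk E u p v \<and> map lab p = \<alpha> \<and> u \<in> A})"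

definition word_range :: "('v, 'e) pre_digraph \<Rightarrow> ('e \<Rightarrow> 'a) \<Rightarrow> 'a list \<Rightarrow> 'v set" where
  "word_range E lab \<alpha> = rel_range E lab (verts E) \<alpha>"

definition out_labels :: "('v, 'e) pre_digraph \<Rightarrow> ('e \<Rightarrow> 'a) \<Rightarrow> 'v set \<Rightarrow> 'a set" where
  "out_labels E lab A = lab ` {e \<in> arcs E. tail E e \<in> A}"

locale labelled_graph = wf_digraph E
  for E :: "('v, 'e) pre_digraph" +
  fixes lab :: "'e \<Rightarrow> 'a"
  assumes verts_nonempty: "verts E \<noteq> {}"
    and alphabet_nonempty: "alphabet E lab \<noteq> {}"

locale labelled_space = labelled_graph E lab
  for E :: "('v, 'e) pre_digraph" and lab :: "'e \<Rightarrow> 'a" +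
  fixes B :: "'v set set"
  assumes B_subset: "B \<subseteq> Pow (verts E)"
    and B_Int: "\<And>A C. \<lbrakk>A \<in> B; C \<in> B\<rbrakk> \<Longrightarrow> A \<inter> C \<in> B"
    and B_Un: "\<And>A C. \<lbrakk>A \<in> B; C \<in> B\<rbrakk> \<Longrightarrow> A \<union> C \<in> B"
    and B_word_range: "\<And>\<alpha>. \<alpha> \<in> label_words1 E lab \<Longrightarrow> word_range E lab \<alpha> \<in> B"
    and B_rel_range: "\<And>A \<alpha>. \<lbrakk>A \<in> B; \<alpha> \<in> label_words E lab\<rbrakk> \<Longrightarrow> rel_range E lab A \<alpha> \<in> B"

locale normal_labelled_space = labelled_space E lab B
  for E :: "('v, 'e) pre_digraph" and lab :: "'e \<Rightarrow> 'a" and B :: "'v set set" +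
  assumes weakly_left_resolving:
      "\<And>A C \<alpha>. \<lbrakk>A \<in> B; C \<in> B; \<alpha> \<in> label_words1 E lab\<rbrakk> \<Longrightarrow>
        rel_range E lab (A \<inter> C) \<alpha> = rel_range E lab A \<alpha> \<inter> rel_range E lab C \<alpha>"
    and B_Diff: "\<And>A C. \<lbrakk>A \<in> B; C \<in> B\<rbrakk> \<Longrightarrow> A - C \<in> B"

definition regular_set ::
    "('v, 'e) pre_digraph \<Rightarrow> ('e \<Rightarrow> 'a) \<Rightarrow> 'v set set \<Rightarrow> 'v set \<Rightarrow> bool" where
  "regular_set E lab B A \<longleftrightarrow> A \<in> B \<and> A \<noteq> {} \<and>
    (\<forall>C\<in>B. C \<noteq> {} \<and> C \<subseteq> A \<longrightarrow>
      finite (out_labels E lab C) \<and> 0 < card (out_labels E lab C))"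

definition B_reg :: "('v, 'e) pre_digraph \<Rightarrow> ('e \<Rightarrow> 'a) \<Rightarrow> 'v set set \<Rightarrow> 'v set set" where
  "B_reg E lab B = insert {} {A. regular_set E lab B A}"


section \<open>Rings and algebras without unit\<close>

text \<open>
  The records of \<^theory>\<open>HOL-Algebra.Ring\<close> and \<^theory>\<open>HOL-Algebra.Module\<close> are reused. No axiom
  mentions their field \<^const>\<open>one\<close>, which carries no information and need not lie in the carrier.
\<close>

locale nonunital_ring = abelian_group R for R (structure) +
  assumes m_closed: "\<lbrakk>x \<in> carrier R; y \<in> carrier R\<rbrakk> \<Longrightarrow> x \<otimes> y \<in> carrier R"
    and m_assoc: "\<lbrakk>x \<in> carrier R; y \<in> carrier R; z \<in> carrier R\<rbrakk> \<Longrightarrow>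
      (x \<otimes> y) \<otimes> z = x \<otimes> (y \<otimes> z)"
    and l_distr: "\<lbrakk>x \<in> carrier R; y \<in> carrier R; z \<in> carrier R\<rbrakk> \<Longrightarrow>
      (x \<oplus> y) \<otimes> z = x \<otimes> z \<oplus> y \<otimes> z"
    and r_distr: "\<lbrakk>x \<in> carrier R; y \<in> carrier R; z \<in> carrier R\<rbrakk> \<Longrightarrow>
      z \<otimes> (x \<oplus> y) = z \<otimes> x \<oplus> z \<otimes> y"

locale nonunital_algebra = nonunital_ring R
  for R :: "('k::field, 'b) module" (structure) +
  assumes smult_closed: "x \<in> carrier R \<Longrightarrow> c \<odot> x \<in> carrier R"
    and smult_l_distr: "x \<in> carrier R \<Longrightarrow> (c + d) \<odot> x = c \<odot> x \<oplus> d \<odot> x"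
    and smult_r_distr: "\<lbrakk>x \<in> carrier R; y \<in> carrier R\<rbrakk> \<Longrightarrow> c \<odot> (x \<oplus> y) = c \<odot> x \<oplus> c \<odot> y"
    and smult_assoc1: "x \<in> carrier R \<Longrightarrow> (c * d) \<odot> x = c \<odot> (d \<odot> x)"
    and smult_one: "x \<in> carrier R \<Longrightarrow> 1 \<odot> x = x"
    and smult_mult_left: "\<lbrakk>x \<in> carrier R; y \<in> carrier R\<rbrakk> \<Longrightarrow> (c \<odot> x) \<otimes> y = c \<odot> (x \<otimes> y)"
    and smult_mult_right: "\<lbrakk>x \<in> carrier R; y \<in> carrier R\<rbrakk> \<Longrightarrow> x \<otimes> (c \<odot> y) = c \<odot> (x \<otimes> y)"

locale ring_ideal = additive_subgroup I R + nonunital_ring R for I and R (structure) +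
  assumes I_l_closed: "\<lbrakk>a \<in> I; x \<in> carrier R\<rbrakk> \<Longrightarrow> x \<otimes> a \<in> I"
    and I_r_closed: "\<lbrakk>a \<in> I; x \<in> carrier R\<rbrakk> \<Longrightarrow> a \<otimes> x \<in> I"

context ring_ideal
begin

lemma abelian_subgroup: "abelian_subgroup I R"
  by (rule abelian_subgroupI3) unfold_locales

lemma rcoset_mult_add:
  assumes "x \<in> carrier R" "y \<in> carrier R"
  shows "rcoset_mult R I (I +> x) (I +> y) = I +> (x \<otimes> y)"
proof -
  interpret abelian_subgroup I R by (rule abelian_subgroup)
  have "I +> (x' \<otimes> y') = I +> (x \<otimes> y)" if x': "x' \<in> I +> x" and y': "y' \<in> I +> y" for x' y'
  proof -
    obtain h k where h: "h \<in> I" "x' = h \<oplus> x" and k: "k \<in> I" "y' = k \<oplus> y"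
      using x' y' by (auto simp: a_r_coset_def r_coset_def)
    note carr = assms h(1)[THEN a_Hcarr] k(1)[THEN a_Hcarr]
    have "x' \<otimes> y' = (h \<otimes> (k \<oplus> y) \<oplus> x \<otimes> k) \<oplus> x \<otimes> y"
      using carr by (simp add: h k l_distr r_distr m_closed a_ac)
    moreover have "h \<otimes> (k \<oplus> y) \<oplus> x \<otimes> k \<in> I"
      using h k carr by (simp add: I_l_closed I_r_closed)
    ultimately have "x' \<otimes> y' \<in> I +> (x \<otimes> y)"
      by (auto simp: a_r_coset_def r_coset_def)
    then show ?thesis
      using assms by (simp add: a_repr_independence' m_closed)
  qed
  then show ?thesis
    unfolding rcoset_mult_def using assms a_rcos_self by blast
qed

lemma quotient_nonunital_ring: "nonunital_ring (R Quot I)"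
proof -
  interpret abelian_subgroup I R by (rule abelian_subgroup)
  interpret Q: abelian_group "R Quot I"
    by (rule comm_group_abelian_groupI)
      (simp add: FactRing_def a_factorgroup_is_comm_group[unfolded A_FactGroup_def'])
  show ?thesis
    by unfold_locales
      (auto simp: FactRing_simps rcoset_mult_add a_rcos_sum m_closed m_assoc l_distr r_distr)
qed

end

locale semiprime_ring = nonunital_ring R for R (structure) +
  assumes semiprime: "\<lbrakk>ring_ideal I R; ideal_prod R I I = {\<zero>}\<rbrakk> \<Longrightarrow> I = {\<zero>}"

locale algebra_ideal = ring_ideal I R + nonunital_algebra R
  for I and R :: "('k::field, 'b) module" (structure) +
  assumes I_smult_closed: "a \<in> I \<Longrightarrow> c \<odot> a \<in> I"

definition generated_ideal :: "('k::field, 'b) module \<Rightarrow> 'b set \<Rightarrow> 'b set" where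
  "generated_ideal R X = \<Inter>{I. algebra_ideal I R \<and> X \<subseteq> I}"

definition quotient_algebra :: "('k::field, 'b) module \<Rightarrow> 'b set \<Rightarrow> ('k, 'b set) module" where
  "quotient_algebra R I = ring.extend (R Quot I)
    (module.fields (\<lambda>c X. \<Union>x\<in>X. I +>\<^bsub>R\<^esub> (c \<odot>\<^bsub>R\<^esub> x)))"

lemma (in algebra_ideal) rcoset_smult:
  assumes "x \<in> carrier R"
  shows "(\<Union>x'\<in>I +> x. I +> (c \<odot> x')) = I +> (c \<odot> x)"
proof -
  interpret abelian_subgroup I R by (rule abelian_subgroup)
  have "I +> (c \<odot> x') = I +> (c \<odot> x)" if x': "x' \<in> I +> x" for x'
  proof -
    obtain h where h: "h \<in> I" "x' = h \<oplus> x"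
      using x' by (auto simp: a_r_coset_def r_coset_def)
    have "c \<odot> x' = c \<odot> h \<oplus> c \<odot> x"
      using assms h by (simp add: smult_r_distr a_Hcarr)
    then have "c \<odot> x' \<in> I +> (c \<odot> x)"
      using I_smult_closed[OF h(1)] by (auto simp: a_r_coset_def r_coset_def)
    then show ?thesis
      using assms by (simp add: a_repr_independence' smult_closed)
  qed
  then show ?thesis
    using assms a_rcos_self by blast
qed

lemma (in algebra_ideal) quotient_nonunital_algebra: "nonunital_algebra (quotient_algebra R I)"
proof -
  interpret abelian_subgroup I R by (rule abelian_subgroup)
  interpret Q: nonunital_ring "R Quot I" by (rule quotient_nonunital_ring)
  have sel: "carrier (quotient_algebra R I) = carrier (R Quot I)"
    "mult (quotient_algebra R I) = mult (R Quot I)"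
    "zero (quotient_algebra R I) = zero (R Quot I)"
    "add (quotient_algebra R I) = add (R Quot I)"
    "smult (quotient_algebra R I) = (\<lambda>c X. \<Union>x\<in>X. I +> (c \<odot> x))"
    by (simp_all add: quotient_algebra_def ring.defs module.defs)
  interpret Q': abelian_group "quotient_algebra R I"
  proof (rule abelian_groupI, unfold sel)
    show "\<exists>y\<in>carrier (R Quot I). y \<oplus>\<^bsub>R Quot I\<^esub> x = \<zero>\<^bsub>R Quot I\<^esub>"
      if "x \<in> carrier (R Quot I)" for x
      using that Q.l_neg by blast
  qed (simp_all add: Q.a_ac)
  have rep: "\<exists>x\<in>carrier R. X = I +> x" if "X \<in> carrier (R Quot I)" for X
    using that by (auto simp: FactRing_simps)
  have ops: "I +> x \<in> carrier (R Quot I)"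
    "smult (quotient_algebra R I) c (I +> x) = I +> (c \<odot> x)"
    "y \<in> carrier R \<Longrightarrow> (I +> x) \<otimes>\<^bsub>R Quot I\<^esub> (I +> y) = I +> (x \<otimes> y)"
    "y \<in> carrier R \<Longrightarrow> (I +> x) \<oplus>\<^bsub>R Quot I\<^esub> (I +> y) = I +> (x \<oplus> y)"
    if "x \<in> carrier R" for x y c
    using that
    by (simp_all only: sel(5) rcoset_smult)
      (auto simp: FactRing_simps rcoset_mult_add a_rcos_sum)
  show ?thesis
    by (unfold_locales, unfold sel(1-4))
      (auto dest!: rep simp: ops m_closed smult_closed m_assoc l_distr r_distr
        smult_l_distr smult_r_distr smult_assoc1 smult_one smult_mult_left smult_mult_right)
qed

lemma (in nonunital_algebra) algebra_ideal_carrier: "algebra_ideal (carrier R) R"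
  by unfold_locales (auto simp: m_closed smult_closed add.subgroup_self)

lemma (in nonunital_algebra) generated_ideal_algebra_ideal:
  assumes "X \<subseteq> carrier R"
  shows "algebra_ideal (generated_ideal R X) R"
proof -
  let ?M = "{I. algebra_ideal I R \<and> X \<subseteq> I}"
  have ne: "carrier R \<in> ?M"
    using assms algebra_ideal_carrier by blast
  have "subgroup (\<Inter>?M) (add_monoid R)"
  proof (rule add.subgroups_Inter)
    show "subgroup I (add_monoid R)" if "I \<in> ?M" for I
      using that by (auto simp: algebra_ideal_def ring_ideal_def additive_subgroup_def)
  qed (use ne in blast)
  then have sub: "additive_subgroup (\<Inter>?M) R"
    by (rule additive_subgroup.intro)
  show ?thesis
    unfolding generated_ideal_def
    by (intro algebra_ideal.intro ring_ideal.intro sub nonunital_algebra_axioms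
          nonunital_ring_axioms ring_ideal_axioms.intro algebra_ideal_axioms.intro)
      (auto intro: ring_ideal.I_l_closed ring_ideal.I_r_closed algebra_ideal.I_smult_closed
        dest: algebra_ideal.axioms(1))
qed


section \<open>The free algebra without unit\<close>

text \<open>
  Words under concatenation, written additively so that finitely supported functions on them carry
  the convolution product of \<^theory>\<open>HOL-Library.Poly_Mapping\<close> and form the free unital algebra.
\<close>

datatype 'g free_word = Word (letters: "'g list")

instantiation free_word :: (type) monoid_add
begin

definition zero_free_word :: "'g free_word" where
  "zero_free_word = Word []"

definition plus_free_word :: "'g free_word \<Rightarrow> 'g free_word \<Rightarrow> 'g free_word" where
  "plus_free_word v w = Word (letters v @ letters w)"

instance
  by standard (simp_all add: zero_free_word_def plus_free_word_def)

end

text \<open>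
  The free associative algebra without unit on \<open>G\<close>: the elements supported on nonempty words over
  \<open>G\<close>. The element \<open>1\<close> is not one of them and merely fills the unused record field.
\<close>

definition free_algebra :: "'g set \<Rightarrow> ('k::field, 'g free_word \<Rightarrow>\<^sub>0 'k) module" where
  "free_algebra G =
    \<lparr>carrier = {f. \<forall>w\<in>Poly_Mapping.keys f. letters w \<noteq> [] \<and> set (letters w) \<subseteq> G},
     mult = (*), one = 1, zero = 0, add = (+),
     smult = (\<lambda>c. Poly_Mapping.map ((*) c))\<rparr>"

definition free_gen :: "'g \<Rightarrow> 'g free_word \<Rightarrow>\<^sub>0 'k::field" where
  "free_gen g = Poly_Mapping.single (Word [g]) 1"

lemma free_algebra_nonunital_algebra:
  "nonunital_algebra (free_algebra G :: ('k::field, 'g free_word \<Rightarrow>\<^sub>0 'k) module)"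
    (is "nonunital_algebra ?F")
proof -
  have sel: "mult ?F = (*)" "add ?F = (+)" "zero ?F = 0"
    "smult ?F = (\<lambda>c f. Poly_Mapping.single 0 c * f)"
    by (simp_all add: free_algebra_def mult_map_scale_conv_mult fun_eq_iff)
  have zero: "0 \<in> carrier ?F"
    by (simp add: free_algebra_def)
  have add: "f + g \<in> carrier ?F" if "f \<in> carrier ?F" "g \<in> carrier ?F" for f g
    using that keys_add[of f g] by (auto simp: free_algebra_def)
  have uminus: "- f \<in> carrier ?F" if "f \<in> carrier ?F" for f
    using that by (simp add: free_algebra_def)
  have mult: "f * g \<in> carrier ?F" if "f \<in> carrier ?F" "g \<in> carrier ?F" for f g
    using that keys_mult[of f g] by (fastforce simp: free_algebra_def plus_free_word_def)
  have scale: "Poly_Mapping.single 0 c * f \<in> carrier ?F" if "f \<in> carrier ?F" for c f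
    using that keys_mult[of "Poly_Mapping.single 0 c" f]
    by (fastforce simp: free_algebra_def split: if_splits)
  have central: "f * Poly_Mapping.single 0 c = Poly_Mapping.single 0 c * f"
    for f :: "'g free_word \<Rightarrow>\<^sub>0 'k" and c
  proof (induction f rule: update_induct)
    case (update f a b)
    then have "Poly_Mapping.update a b f = f + Poly_Mapping.single a b"
      by (intro poly_mapping_eqI)
        (auto simp: lookup_update lookup_add lookup_single in_keys_iff when_def)
    then show ?case
      using update.IH by (simp add: distrib_left distrib_right mult_single mult.commute)
  qed simp
  have scale_scale: "Poly_Mapping.single 0 (c * d) * f =
      Poly_Mapping.single 0 c * (Poly_Mapping.single 0 d * f)"
    for f :: "'g free_word \<Rightarrow>\<^sub>0 'k" and c d
    by (simp add: mult_single flip: mult.assoc)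
  have scale_right: "f * (Poly_Mapping.single 0 c * g) = Poly_Mapping.single 0 c * (f * g)"
    for f g :: "'g free_word \<Rightarrow>\<^sub>0 'k" and c
    by (metis central mult.assoc)
  have "abelian_group ?F"
    by (rule abelian_groupI, unfold sel)
      (use zero add in \<open>auto simp: algebra_simps intro!: bexI[OF _ uminus]\<close>)
  then show ?thesis
    by (intro nonunital_algebra.intro nonunital_ring.intro nonunital_ring_axioms.intro
        nonunital_algebra_axioms.intro, unfold sel)
      (assumption | rule mult scale scale_scale scale_right mult.assoc distrib_left distrib_right
        | simp add: single_add distrib_right)+
qed

lemma free_gen_in_carrier: "g \<in> G \<Longrightarrow> free_gen g \<in> carrier (free_algebra G)"
  by (simp add: free_gen_def free_algebra_def)


section \<open>Leavitt labelled path algebras\<close>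

datatype ('v, 'a) lpa_gen = Proj "'v set" | Edge 'a | Ghost 'a

type_synonym ('v, 'a, 'k) lpa_free = "('v, 'a) lpa_gen free_word \<Rightarrow>\<^sub>0 'k"

abbreviation lpa_p :: "'v set \<Rightarrow> ('v, 'a, 'k::field) lpa_free" where
  "lpa_p A \<equiv> free_gen (Proj A)"

abbreviation lpa_s :: "'a \<Rightarrow> ('v, 'a, 'k::field) lpa_free" where
  "lpa_s a \<equiv> free_gen (Edge a)"

abbreviation lpa_s_star :: "'a \<Rightarrow> ('v, 'a, 'k::field) lpa_free" where
  "lpa_s_star a \<equiv> free_gen (Ghost a)"

definition lpa_generators ::
    "('v, 'e) pre_digraph \<Rightarrow> ('e \<Rightarrow> 'a) \<Rightarrow> 'v set set \<Rightarrow> ('v, 'a) lpa_gen set" where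
  "lpa_generators E lab B = Proj ` B \<union> Edge ` alphabet E lab \<union> Ghost ` alphabet E lab"

inductive lpa_relation ::
    "('v, 'e) pre_digraph \<Rightarrow> ('e \<Rightarrow> 'a) \<Rightarrow> 'v set set \<Rightarrow>
      ('v, 'a, 'k::field) lpa_free \<Rightarrow> ('v, 'a, 'k) lpa_free \<Rightarrow> bool"
  for E lab B where
  p_Int: "\<lbrakk>A \<in> B; C \<in> B\<rbrakk> \<Longrightarrow> lpa_relation E lab B (lpa_p (A \<inter> C)) (lpa_p A * lpa_p C)"
| p_Un: "\<lbrakk>A \<in> B; C \<in> B\<rbrakk> \<Longrightarrow>
    lpa_relation E lab B (lpa_p (A \<union> C)) (lpa_p A + lpa_p C - lpa_p (A \<inter> C))"
| p_empty: "lpa_relation E lab B (lpa_p {}) 0"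
| p_s: "\<lbrakk>A \<in> B; a \<in> alphabet E lab\<rbrakk> \<Longrightarrow>
    lpa_relation E lab B (lpa_p A * lpa_s a) (lpa_s a * lpa_p (rel_range E lab A [a]))"
| s_star_p: "\<lbrakk>A \<in> B; a \<in> alphabet E lab\<rbrakk> \<Longrightarrow>
    lpa_relation E lab B (lpa_s_star a * lpa_p A) (lpa_p (rel_range E lab A [a]) * lpa_s_star a)"
| s_star_s: "a \<in> alphabet E lab \<Longrightarrow>
    lpa_relation E lab B (lpa_s_star a * lpa_s a) (lpa_p (word_range E lab [a]))"
| s_star_s_neq: "\<lbrakk>a \<in> alphabet E lab; b \<in> alphabet E lab; b \<noteq> a\<rbrakk> \<Longrightarrow>
    lpa_relation E lab B (lpa_s_star b * lpa_s a) 0"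
| s_s_star_s: "a \<in> alphabet E lab \<Longrightarrow>
    lpa_relation E lab B (lpa_s a * lpa_s_star a * lpa_s a) (lpa_s a)"
| s_star_s_s_star: "a \<in> alphabet E lab \<Longrightarrow>
    lpa_relation E lab B (lpa_s_star a * lpa_s a * lpa_s_star a) (lpa_s_star a)"
| p_regular: "A \<in> B_reg E lab B \<Longrightarrow>
    lpa_relation E lab B (lpa_p A)
      (\<Sum>a\<in>out_labels E lab A. lpa_s a * lpa_p (rel_range E lab A [a]) * lpa_s_star a)"

text \<open>
  The algebra presented by these generators and relations. The empty set lies in \<open>B\<close> as soon as the
  labelled space is normal, so that all relations are between elements of the free algebra.
\<close>

definition leavitt_labelled_path_algebra ::
    "('v, 'e) pre_digraph \<Rightarrow> ('e \<Rightarrow> 'a) \<Rightarrow> 'v set set \<Rightarrow>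
      ('k::field, ('v, 'a, 'k) lpa_free set) module" where
  "leavitt_labelled_path_algebra E lab B =
    (let F = free_algebra (lpa_generators E lab B)
     in quotient_algebra F (generated_ideal F {x - y | x y. lpa_relation E lab B x y}))"

lemma (in labelled_graph) label_in_label_words1:
  assumes "a \<in> alphabet E lab"
  shows "[a] \<in> label_words1 E lab"
proof -
  obtain e where e: "e \<in> arcs E" "a = lab e"
    using assms by (auto simp: alphabet_def)
  then have "pre_digraph.awalk E (tail E e) [e] (head E e)"
    by (simp add: pre_digraph.awalk_def pre_digraph.cas.simps)
  then have "map lab [e] \<in> path_labels E lab 1"
    unfolding path_labels_def by (intro CollectI exI conjI) auto
  then show ?thesis
    unfolding label_words1_def using e(2) by (intro UN_I[of 1]) auto
qed

lemma (in normal_labelled_space) empty_in_B: "{} \<in> B"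
proof -
  obtain a where "a \<in> alphabet E lab"
    using alphabet_nonempty by blast
  then have "word_range E lab [a] \<in> B"
    by (intro B_word_range label_in_label_words1)
  from B_Diff[OF this this] show ?thesis
    by simp
qed

lemma (in normal_labelled_space) lpa_relation_in_carrier:
  assumes "lpa_relation E lab B x (y :: ('v, 'a, 'k::field) lpa_free)"
  shows "x \<in> carrier (free_algebra (lpa_generators E lab B))"
    and "y \<in> carrier (free_algebra (lpa_generators E lab B))"
proof -
  let ?F = "free_algebra (lpa_generators E lab B) :: ('k, ('v, 'a, 'k) lpa_free) module"
  interpret F: nonunital_algebra ?F
    by (rule free_algebra_nonunital_algebra)
  have zero: "0 \<in> carrier ?F"
    using F.zero_closed by (simp add: free_algebra_def)
  have add: "f + g \<in> carrier ?F" if "f \<in> carrier ?F" "g \<in> carrier ?F" for f g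
    using F.a_closed[OF that] by (simp add: free_algebra_def)
  have diff: "f - g \<in> carrier ?F" if "f \<in> carrier ?F" "g \<in> carrier ?F" for f g
    using that keys_diff[of f g] by (auto simp: free_algebra_def)
  have mult: "f * g \<in> carrier ?F" if "f \<in> carrier ?F" "g \<in> carrier ?F" for f g
    using F.m_closed[OF that] by (simp add: free_algebra_def)
  have sum: "sum f S \<in> carrier ?F" if "\<And>i. i \<in> S \<Longrightarrow> f i \<in> carrier ?F" for f and S :: "'a set"
    using that by (induction S rule: infinite_finite_induct) (simp_all add: zero add)
  have p: "lpa_p A \<in> carrier ?F" if "A \<in> B" for A
    using that by (intro free_gen_in_carrier) (simp add: lpa_generators_def)
  have s: "lpa_s a \<in> carrier ?F" "lpa_s_star a \<in> carrier ?F" if "a \<in> alphabet E lab" for a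
    using that by (simp_all add: free_gen_in_carrier lpa_generators_def)
  have r: "rel_range E lab A [a] \<in> B" if "A \<in> B" "a \<in> alphabet E lab" for A a
    using that by (simp add: B_rel_range label_words_def label_in_label_words1)
  have wr: "word_range E lab [a] \<in> B" if "a \<in> alphabet E lab" for a
    using that by (simp add: B_word_range label_in_label_words1)
  have reg: "A \<in> B" if "A \<in> B_reg E lab B" for A
    using that empty_in_B by (auto simp: B_reg_def regular_set_def)
  have out: "a \<in> alphabet E lab" if "a \<in> out_labels E lab A" for a A
    using that by (auto simp: out_labels_def alphabet_def)
  note closed = zero add diff mult p s r wr reg empty_in_B B_Int B_Un
  show "x \<in> carrier ?F"
    using assms by cases (simp_all add: closed)
  show "y \<in> carrier ?F"
    using assms
    by cases (auto simp: closed intro!: sum mult p s r intro: reg out)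
qed

lemma (in normal_labelled_space) leavitt_labelled_path_algebra_nonunital_algebra:
  "nonunital_algebra
    (leavitt_labelled_path_algebra E lab B :: ('k::field, ('v, 'a, 'k) lpa_free set) module)"
proof -
  let ?F = "free_algebra (lpa_generators E lab B) :: ('k, ('v, 'a, 'k) lpa_free) module"
  let ?X = "{x - y | x y :: ('v, 'a, 'k) lpa_free. lpa_relation E lab B x y}"
  interpret F: nonunital_algebra ?F
    by (rule free_algebra_nonunital_algebra)
  have diff: "x - y \<in> carrier ?F" if "x \<in> carrier ?F" "y \<in> carrier ?F" for x y
    using that keys_diff[of x y] by (auto simp: free_algebra_def)
  have "?X \<subseteq> carrier ?F"
    using lpa_relation_in_carrier diff by blast
  then interpret J: algebra_ideal "generated_ideal ?F ?X" ?F
    by (rule F.generated_ideal_algebra_ideal)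
  show ?thesis
    using J.quotient_nonunital_algebra by (simp add: leavitt_labelled_path_algebra_def Let_def)
qed

end

theory Submission
  imports Defs
begin

text \<open>
  Write \<open>L\<close> for the algebra. It suffices to find for every \<open>x \<noteq> 0\<close> in \<open>L\<close> some \<open>z \<in> L\<close> with
  \<open>x z x \<noteq> 0\<close>: if \<open>x\<close> lies in an ideal \<open>I\<close>, then \<open>x z x\<close> is a product of the elements \<open>x z\<close> and \<open>x\<close>
  of \<open>I\<close>.

  The defining relations are homogeneous when projections have degree \<open>0\<close>, edges degree \<open>1\<close> and ghost
  edges degree \<open>- 1\<close>, so \<open>L\<close> is graded over the integers. If \<open>h\<close> is the leading component of \<open>x\<close>
  and \<open>z\<close> is homogeneous, then the component of \<open>x z x\<close> in the largest degree that can occur is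
  \<open>h z h\<close>. This reduces the claim to homogeneous \<open>x\<close> (\<open>unital_ideal_semiprime\<close>).

  A homogeneous \<open>x \<noteq> 0\<close> is a sum of monomials \<open>s\<^sub>\<alpha> p\<^sub>A s\<^sub>\<beta>\<^sup>*\<close> with \<open>|\<alpha>| - |\<beta>|\<close> constant. Multiplying
  from the right by an edge shortens the words \<open>\<beta>\<close>. As long as ghost edges remain and some product
  \<open>x s\<^sub>a\<close> is nonzero, replace \<open>x\<close> by it. When this is no longer possible, \<open>x\<close> is killed by \<open>s\<^sub>a s\<^sub>a\<^sup>*\<close>
  for all of the finitely many ghost edges \<open>s\<^sub>a\<^sup>*\<close> in which its monomials end, and therefore has the
  form \<open>w f\<close>, where \<open>w\<close> is a combination of terms \<open>s\<^sub>\<alpha> p\<^sub>A\<close> with \<open>|\<alpha>|\<close> constant and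
  \<open>f = 1 - \<Sum>\<^sub>a s\<^sub>a s\<^sub>a\<^sup>*\<close>, summed over these \<open>a\<close>, is an idempotent commuting with all projections
  (\<open>monomials_reduce\<close>). Multiplying from the left by ghost edges strips the words \<open>\<alpha>\<close> without
  killing the element and leaves \<open>q f \<noteq> 0\<close>, with \<open>q\<close> a combination of projections
  (\<open>left_span_reduce\<close>). Commuting idempotents can be diagonalised simultaneously, so that a further
  idempotent factor turns \<open>q f\<close> into \<open>c e\<close> with a scalar \<open>c\<close> and an idempotent \<open>e\<close>
  (\<open>diag_scalar_corner\<close>). Altogether \<open>u x v = c e \<noteq> 0\<close>, and then \<open>u x v u x v = c\<^sup>2 e \<noteq> 0\<close>, so
  \<open>x v u x \<noteq> 0\<close> (\<open>monomials_nondegenerate\<close>).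

  The elements \<open>1\<close>, \<open>f\<close>, \<open>u\<close> and \<open>v\<close> live in an algebra with unit that contains \<open>L\<close>. Computations are
  therefore made in the full ring of noncommutative polynomials, modulo an ideal \<open>unital_ideal\<close> that
  meets the free algebra without unit in the ideal of relations. Passing from \<open>x\<close> to \<open>x y x\<close>
  twice moves the middle factor back into \<open>L\<close> (\<open>lpa_ideal_semiprime\<close>).
\<close>

section \<open>Congruence modulo an ideal\<close>

locale congruence_ideal =
  fixes J :: "'r::ring_1 set"
  assumes zero_mem: "0 \<in> J"
    and add_mem: "\<lbrakk>x \<in> J; y \<in> J\<rbrakk> \<Longrightarrow> x + y \<in> J"
    and mult_left_mem: "x \<in> J \<Longrightarrow> z * x \<in> J"
    and mult_right_mem: "x \<in> J \<Longrightarrow> x * z \<in> J"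
begin

definition eqv :: "'r \<Rightarrow> 'r \<Rightarrow> bool" (infix "\<approx>" 50) where
  "x \<approx> y \<longleftrightarrow> x - y \<in> J"

lemma uminus_mem: "x \<in> J \<Longrightarrow> - x \<in> J"
  using mult_left_mem[of x "-1"] by simp

lemma eqv_zero_iff: "x \<approx> 0 \<longleftrightarrow> x \<in> J"
  by (simp add: eqv_def)

lemma eqv_refl [simp, intro]: "x \<approx> x"
  by (simp add: eqv_def zero_mem)

lemma eqv_sym: "x \<approx> y \<Longrightarrow> y \<approx> x"
  using uminus_mem[of "x - y"] by (simp add: eqv_def)

lemma eqv_trans [trans]: "\<lbrakk>x \<approx> y; y \<approx> z\<rbrakk> \<Longrightarrow> x \<approx> z"
  using add_mem[of "x - y" "y - z"] by (simp add: eqv_def)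

lemma eqv_add: "\<lbrakk>x \<approx> x'; y \<approx> y'\<rbrakk> \<Longrightarrow> x + y \<approx> x' + y'"
  using add_mem[of "x - x'" "y - y'"] by (simp add: eqv_def algebra_simps)

lemma eqv_uminus: "x \<approx> x' \<Longrightarrow> - x \<approx> - x'"
  using uminus_mem[of "x - x'"] by (simp add: eqv_def)

lemma eqv_diff: "\<lbrakk>x \<approx> x'; y \<approx> y'\<rbrakk> \<Longrightarrow> x - y \<approx> x' - y'"
  using eqv_add[OF _ eqv_uminus, of x x' y y'] by simp

lemma eqv_mult: "\<lbrakk>x \<approx> x'; y \<approx> y'\<rbrakk> \<Longrightarrow> x * y \<approx> x' * y'"
  using add_mem[OF mult_right_mem[of "x - x'" y] mult_left_mem[of "y - y'" x']]
  by (simp add: eqv_def algebra_simps)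

lemma eqv_mult_left: "x \<approx> x' \<Longrightarrow> z * x \<approx> z * x'"
  by (simp add: eqv_mult)

lemma eqv_mult_right: "x \<approx> x' \<Longrightarrow> x * z \<approx> x' * z"
  by (simp add: eqv_mult)

lemma eqv_sum: "(\<And>i. i \<in> F \<Longrightarrow> f i \<approx> g i) \<Longrightarrow> sum f F \<approx> sum g F"
  by (induction F rule: infinite_finite_induct) (auto intro: eqv_add)

end

section \<open>Algebras generated by partial isometries\<close>

text \<open>
  The relations of a Leavitt labelled path algebra between projections (\<open>P\<close>), edges (\<open>s\<close>) and ghost
  edges (\<open>t\<close>), read modulo \<open>J\<close>. The unit is counted among the projections so that the monomials
  \<open>s\<^sub>\<alpha> p t\<^sub>\<beta>\<close> include the plain words \<open>s\<^sub>\<alpha> t\<^sub>\<beta>\<close>. All letters \<open>a\<close> of the type are admitted; those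
  outside an alphabet may act as zero.
\<close>
locale isometry_algebra = congruence_ideal J
  for J :: "'r::ring_1 set" +
  fixes P :: "'r set" and s t :: "'a \<Rightarrow> 'r" and k :: "'k::field \<Rightarrow> 'r"
  assumes P_one: "1 \<in> P"
    and P_mult: "\<lbrakk>p \<in> P; q \<in> P\<rbrakk> \<Longrightarrow> p * q \<in> P"
    and P_commute: "\<lbrakk>p \<in> P; q \<in> P\<rbrakk> \<Longrightarrow> p * q \<approx> q * p"
    and P_idem: "p \<in> P \<Longrightarrow> p * p \<approx> p"
    and P_shift: "p \<in> P \<Longrightarrow> \<exists>q\<in>P. p * s a \<approx> s a * q \<and> t a * p \<approx> q * t a"
    and t_s: "t a * s a \<in> P"
    and t_s_neq: "a \<noteq> b \<Longrightarrow> t a * s b \<approx> 0"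
    and s_t_s: "s a * t a * s a \<approx> s a"
    and t_s_t: "t a * s a * t a \<approx> t a"
    and k_add: "k (c + d) = k c + k d"
    and k_mult: "k (c * d) = k c * k d"
    and k_one: "k 1 = 1"
    and k_central: "k c * x = x * k c"
begin

lemma k_zero: "k 0 = 0"
  using k_add[of 0 0] by simp

text \<open>
  Each \<open>s\<^sub>a t\<^sub>a\<close> is an idempotent, the projection onto the range of \<open>s\<^sub>a\<close>, and these are orthogonal.
\<close>
definition \<phi> :: "'a set \<Rightarrow> 'r" where
  "\<phi> F = (\<Sum>a\<in>F. s a * t a)"

lemma \<phi>_s: "finite F \<Longrightarrow> \<phi> F * s a \<approx> (if a \<in> F then s a else 0)"
proof -
  assume F: "finite F"
  have "\<phi> F * s a = (\<Sum>b\<in>F. s b * (t b * s a))"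
    by (simp add: \<phi>_def sum_distrib_right mult.assoc)
  also have "\<dots> \<approx> (\<Sum>b\<in>F. if b = a then s b else 0)"
    using s_t_s eqv_mult_left[OF t_s_neq] by (intro eqv_sum) (auto simp: mult.assoc)
  also have "\<dots> = (if a \<in> F then s a else 0)"
    using F by simp
  finally show ?thesis .
qed

lemma t_\<phi>: "finite F \<Longrightarrow> t a * \<phi> F \<approx> (if a \<in> F then t a else 0)"
proof -
  assume F: "finite F"
  have "t a * \<phi> F = (\<Sum>b\<in>F. t a * s b * t b)"
    by (simp add: \<phi>_def sum_distrib_left mult.assoc)
  also have "\<dots> \<approx> (\<Sum>b\<in>F. if b = a then t b else 0)"
    using t_s_t eqv_mult_right[OF t_s_neq] by (intro eqv_sum) auto
  also have "\<dots> = (if a \<in> F then t a else 0)"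
    using F by simp
  finally show ?thesis .
qed

lemma \<phi>_mult:
  assumes "finite F" "finite F'" "F \<subseteq> F'"
  shows "\<phi> F * \<phi> F' \<approx> \<phi> F" and "\<phi> F' * \<phi> F \<approx> \<phi> F"
proof -
  have "s a * (t a * \<phi> F') \<approx> s a * t a" if "a \<in> F" for a
    using eqv_mult_left[OF t_\<phi>[of F' a]] assms that by auto
  then show "\<phi> F * \<phi> F' \<approx> \<phi> F"
    unfolding \<phi>_def[of F] sum_distrib_right mult.assoc by (rule eqv_sum)
  have "(\<phi> F' * s a) * t a \<approx> s a * t a" if "a \<in> F" for a
    using eqv_mult_right[OF \<phi>_s[of F' a]] assms that by auto
  then show "\<phi> F' * \<phi> F \<approx> \<phi> F"
    unfolding \<phi>_def[of F] sum_distrib_left mult.assoc[symmetric] by (rule eqv_sum)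
qed

lemma \<phi>_commute:
  assumes "p \<in> P"
  shows "p * \<phi> F \<approx> \<phi> F * p"
proof -
  have "p * (s a * t a) \<approx> s a * t a * p" for a
  proof -
    obtain q where "q \<in> P" and q: "p * s a \<approx> s a * q" "t a * p \<approx> q * t a"
      using P_shift[OF assms] by blast
    have "p * (s a * t a) \<approx> s a * q * t a"
      using eqv_mult_right[OF q(1)] by (simp add: mult.assoc)
    also have "\<dots> \<approx> s a * t a * p"
      using eqv_mult_left[OF eqv_sym[OF q(2)]] by (simp add: mult.assoc)
    finally show ?thesis .
  qed
  then show ?thesis
    unfolding \<phi>_def sum_distrib_left sum_distrib_right by (intro eqv_sum)
qed

lemma compl_\<phi>_mult:
  assumes "finite F" "finite F'" "F \<subseteq> F'"
  shows "(1 - \<phi> F) * (1 - \<phi> F') \<approx> 1 - \<phi> F'"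
proof -
  have "(1 - \<phi> F) * (1 - \<phi> F') = (1 - \<phi> F') - (\<phi> F - \<phi> F * \<phi> F')"
    by (simp add: algebra_simps)
  also have "\<dots> \<approx> (1 - \<phi> F') - (\<phi> F - \<phi> F)"
    using \<phi>_mult[OF assms] by (intro eqv_diff) auto
  finally show ?thesis
    by simp
qed

lemma compl_\<phi>_commute:
  assumes "p \<in> P"
  shows "p * (1 - \<phi> F) \<approx> (1 - \<phi> F) * p"
  using eqv_diff[OF eqv_refl \<phi>_commute[OF assms]] by (simp add: algebra_simps)

subsection \<open>Combinations of projections\<close>

text \<open>
  The commutative subalgebra spanned by the projections.
\<close>
inductive_set diag :: "'r set" where
  zero: "0 \<in> diag"
| step: "\<lbrakk>p \<in> P; q \<in> diag\<rbrakk> \<Longrightarrow> k c * p + q \<in> diag"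
| eqv: "\<lbrakk>q \<in> diag; q \<approx> q'\<rbrakk> \<Longrightarrow> q' \<in> diag"

lemma diag_scale: "p \<in> P \<Longrightarrow> k c * p \<in> diag"
  using diag.step[OF _ diag.zero] by simp

lemma diag_add: "x \<in> diag \<Longrightarrow> y \<in> diag \<Longrightarrow> x + y \<in> diag"
  by (induction rule: diag.induct) (auto simp: add.assoc intro: diag.intros eqv_add)

lemma diag_mult: "q \<in> diag \<Longrightarrow> p \<in> P \<Longrightarrow> q * p \<in> diag"
  by (induction rule: diag.induct)
    (auto simp: distrib_right mult.assoc intro: diag.intros eqv_mult_right P_mult)

lemma diag_shift: "q \<in> diag \<Longrightarrow> \<exists>q'\<in>diag. q * s a \<approx> s a * q' \<and> t a * q \<approx> q' * t a"
proof (induction rule: diag.induct)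
  case zero
  show ?case by (intro bexI[of _ 0]) (auto intro: diag.zero)
next
  case (step p q c)
  obtain p' where p': "p' \<in> P" "p * s a \<approx> s a * p'" "t a * p \<approx> p' * t a"
    using P_shift[OF step(1)] by blast
  obtain q' where q': "q' \<in> diag" "q * s a \<approx> s a * q'" "t a * q \<approx> q' * t a"
    using step.IH by blast
  have "(k c * p + q) * s a = k c * (p * s a) + q * s a"
    by (simp add: algebra_simps)
  also have "\<dots> \<approx> k c * (s a * p') + s a * q'"
    by (intro eqv_add eqv_mult_left p' q')
  also have "\<dots> = s a * (k c * p' + q')"
    by (simp add: distrib_left mult.assoc[symmetric] k_central[of _ "s a"])
  finally have 1: "(k c * p + q) * s a \<approx> s a * (k c * p' + q')" .
  have "t a * (k c * p + q) = k c * (t a * p) + t a * q"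
    by (simp add: distrib_left mult.assoc[symmetric] k_central[of _ "t a"])
  also have "\<dots> \<approx> k c * (p' * t a) + q' * t a"
    by (intro eqv_add eqv_mult_left p' q')
  also have "\<dots> = (k c * p' + q') * t a"
    by (simp add: algebra_simps)
  finally show ?case
    using 1 p'(1) q'(1) diag.step by blast
next
  case (eqv q r)
  then obtain q' where q': "q' \<in> diag" "q * s a \<approx> s a * q'" "t a * q \<approx> q' * t a"
    by blast
  then show ?case
    using eqv_mult_left[OF eqv_sym[OF eqv(2)]] eqv_mult_right[OF eqv_sym[OF eqv(2)]]
    by (intro bexI[of _ q']) (blast intro: eqv_trans)+
qed

text \<open>
  The commuting idempotents that occur in \<open>q\<close> split \<open>e\<close> into orthogonal pieces on which \<open>q\<close> acts by a
  scalar, and \<open>q e \<noteq> 0\<close> forces one of them to be nonzero. The induction adds one idempotent at a time;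
  the summand \<open>k c\<close> carries the coefficients of those already known to act as \<open>1\<close> on the piece.
\<close>
lemma diag_scalar_corner:
  assumes "q \<in> diag" "e * e \<approx> e" "\<And>p. p \<in> P \<Longrightarrow> p * e \<approx> e * p" "\<not> (k c + q) * e \<approx> 0"
  shows "\<exists>c' e'. e' * e' \<approx> e' \<and> e * e' \<approx> e' \<and> (k c + q) * e' \<approx> k c' * e' \<and> \<not> k c' * e' \<approx> 0"
  using assms
proof (induction arbitrary: c e rule: diag.induct)
  case zero
  then show ?case by (intro exI[of _ c] exI[of _ e]) auto
next
  case (step p q d)
  let ?x = "k c + (k d * p + q)"
  have pp: "p * p \<approx> p" and pe: "p * e \<approx> e * p"
    using step by (auto intro: P_idem)
  have comm: "r * (p * e) \<approx> p * e * r" if "r \<in> P" for r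
  proof -
    have "r * (p * e) \<approx> p * r * e"
      using eqv_mult_right[OF P_commute[OF that step(1)]] by (simp add: mult.assoc)
    also have "\<dots> \<approx> p * e * r"
      using eqv_mult_left[OF step.prems(2)[OF that]] by (simp add: mult.assoc)
    finally show ?thesis .
  qed
  have idem: "p * e * (p * e) \<approx> p * e"
  proof -
    have "p * e * (p * e) \<approx> p * (p * e) * e"
      using eqv_mult_left[OF eqv_mult_right[OF eqv_sym[OF pe]]] by (simp add: mult.assoc)
    also have "p * (p * e) * e = (p * p) * (e * e)"
      by (simp add: mult.assoc)
    also have "\<dots> \<approx> p * e"
      by (intro eqv_mult pp step)
    finally show ?thesis .
  qed
  have epe: "e * (p * e) \<approx> p * e"
  proof -
    have "e * (p * e) \<approx> p * e * e"
      using eqv_mult_right[OF eqv_sym[OF pe]] by (simp add: mult.assoc)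
    also have "\<dots> \<approx> p * e"
      using eqv_mult_left[OF step.prems(1)] by (simp add: mult.assoc)
    finally show ?thesis .
  qed
  have pee: "p * e * e \<approx> p * e"
    using eqv_mult_left[OF step.prems(1)] by (simp add: mult.assoc)
  show ?case
  \<comment> \<open>\<open>p\<close> splits \<open>e\<close> into \<open>p e\<close>, where \<open>k d * p\<close> contributes the scalar \<open>d\<close>, and \<open>e - p e\<close>, where it vanishes.\<close>
  proof (cases "(k (c + d) + q) * (p * e) \<approx> 0")
    case False
    then obtain c' e' where e': "e' * e' \<approx> e'" "p * e * e' \<approx> e'"
      "(k (c + d) + q) * e' \<approx> k c' * e'" "\<not> k c' * e' \<approx> 0"
      using step.IH[OF idem comm] by blast
    have pe': "p * e' \<approx> e'"
    proof -
      have "p * e' \<approx> p * (p * e * e')" by (rule eqv_mult_left[OF eqv_sym[OF e'(2)]])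
      also have "\<dots> = p * p * (e * e')" by (simp add: mult.assoc)
      also have "\<dots> \<approx> p * (e * e')" by (intro eqv_mult_right pp)
      also have "\<dots> = p * e * e'" by (simp add: mult.assoc)
      also have "\<dots> \<approx> e'" by (rule e')
      finally show ?thesis .
    qed
    have ee': "e * e' \<approx> e'"
    proof -
      have "e * e' \<approx> e * (p * e * e')" by (rule eqv_mult_left[OF eqv_sym[OF e'(2)]])
      also have "\<dots> = e * (p * e) * e'" by (simp add: mult.assoc)
      also have "\<dots> \<approx> p * e * e'" by (intro eqv_mult_right epe)
      also have "\<dots> \<approx> e'" by (rule e')
      finally show ?thesis .
    qed
    have "?x * e' = (k c + q) * e' + k d * (p * e')"
      by (simp add: algebra_simps)
    also have "\<dots> \<approx> (k c + q) * e' + k d * e'"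
      by (intro eqv_add eqv_mult_left pe' eqv_refl)
    also have "\<dots> = (k (c + d) + q) * e'"
      by (simp add: algebra_simps k_add)
    also have "\<dots> \<approx> k c' * e'" by (rule e')
    finally show ?thesis using e' ee' by blast
  next
    case True
    let ?f = "e - p * e"
    have fidem: "?f * ?f \<approx> ?f"
    proof -
      have "?f * ?f = e * e - e * (p * e) - p * e * e + p * e * (p * e)"
        by (simp add: algebra_simps)
      also have "\<dots> \<approx> e - p * e - p * e + p * e"
        by (intro eqv_add eqv_diff step.prems(1) epe pee idem)
      finally show ?thesis by simp
    qed
    have fcomm: "r * ?f \<approx> ?f * r" if "r \<in> P" for r
      using eqv_diff[OF step.prems(2)[OF that] comm[OF that]] by (simp add: algebra_simps)
    have pf: "p * ?f \<approx> 0"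
      using eqv_diff[OF eqv_refl eqv_mult_right[OF pp, of e], of "p * e"]
      by (simp add: algebra_simps)
    have "?x * e = (k (c + d) + q) * (p * e) + (k c + q) * ?f"
      by (simp add: algebra_simps k_add)
    also have "\<dots> \<approx> 0 + (k c + q) * ?f"
      by (rule eqv_add[OF True eqv_refl])
    finally have "?x * e \<approx> (k c + q) * ?f"
      by simp
    then have "\<not> (k c + q) * ?f \<approx> 0"
      using step.prems(3) eqv_trans by blast
    then obtain c' e' where e': "e' * e' \<approx> e'" "?f * e' \<approx> e'"
      "(k c + q) * e' \<approx> k c' * e'" "\<not> k c' * e' \<approx> 0"
      using step.IH[OF fidem fcomm] by blast
    have pe': "p * e' \<approx> 0"
    proof -
      have "p * e' \<approx> p * (?f * e')" by (rule eqv_mult_left[OF eqv_sym[OF e'(2)]])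
      also have "\<dots> = p * ?f * e'" by (simp add: mult.assoc)
      also have "\<dots> \<approx> 0 * e'" by (intro eqv_mult_right pf)
      finally show ?thesis by simp
    qed
    have ef: "e * ?f \<approx> ?f"
      using eqv_diff[OF step.prems(1) epe] by (simp add: algebra_simps)
    have ee': "e * e' \<approx> e'"
    proof -
      have "e * e' \<approx> e * (?f * e')" by (rule eqv_mult_left[OF eqv_sym[OF e'(2)]])
      also have "\<dots> = e * ?f * e'" by (simp add: mult.assoc)
      also have "\<dots> \<approx> ?f * e'" by (intro eqv_mult_right ef)
      also have "\<dots> \<approx> e'" by (rule e')
      finally show ?thesis .
    qed
    have "?x * e' = (k c + q) * e' + k d * (p * e')"
      by (simp add: algebra_simps)
    also have "\<dots> \<approx> k c' * e' + k d * 0"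
      by (intro eqv_add eqv_mult_left pe' e')
    finally have "?x * e' \<approx> k c' * e'" by simp
    then show ?thesis using e' ee' by blast
  qed
next
  case (eqv q r)
  have *: "(k c + q) * f \<approx> (k c + r) * f" for f
    by (rule eqv_mult_right[OF eqv_add[OF eqv_refl eqv.hyps(2)]])
  have "\<not> (k c + q) * e \<approx> 0"
    using eqv.prems(3) eqv_trans[OF eqv_sym[OF *]] by blast
  then obtain c' e' where e': "e' * e' \<approx> e'" "e * e' \<approx> e'"
    "(k c + q) * e' \<approx> k c' * e'" "\<not> k c' * e' \<approx> 0"
    using eqv.IH[OF eqv.prems(1,2)] by blast
  then show ?case
    using eqv_trans[OF eqv_sym[OF *] e'(3)] by blast
qed

subsection \<open>Combinations of edge words and projections\<close>

text \<open>
  The sums of terms \<open>s\<^sub>\<alpha> q\<^sub>\<alpha>\<close> with \<open>|\<alpha>| = n\<close> and \<open>q\<^sub>\<alpha>\<close> in the span of the projections. They are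
  described intrinsically, by what ghost edges do to them from the left: this avoids choosing
  coefficients, and \<open>x \<approx> \<phi> F * x\<close> says that the finitely many \<open>t\<^sub>a x\<close> determine \<open>x\<close>.
\<close>
fun left_span :: "nat \<Rightarrow> 'r set" where
  "left_span 0 = diag"
| "left_span (Suc n) = {x. (\<exists>F. finite F \<and> x \<approx> \<phi> F * x) \<and> (\<forall>a. t a * x \<in> left_span n)}"

lemma left_span_eqv: "x \<in> left_span n \<Longrightarrow> x \<approx> y \<Longrightarrow> y \<in> left_span n"
proof (induction n arbitrary: x y)
  case 0
  then show ?case by (auto intro: diag.eqv)
next
  case (Suc n)
  then obtain F where F: "finite F" "x \<approx> \<phi> F * x" by auto
  have "y \<approx> \<phi> F * y"
    using F(2) Suc.prems(2) eqv_mult_left[OF Suc.prems(2)] eqv_sym eqv_trans by blast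
  moreover have "t a * y \<in> left_span n" for a
    using Suc.prems Suc.IH[OF _ eqv_mult_left[OF Suc.prems(2)]] by simp
  ultimately show ?case using F by auto
qed

lemma left_span_zero: "0 \<in> left_span n"
  by (induction n) (auto intro: diag.zero)

lemma \<phi>_mono:
  assumes "x \<approx> \<phi> F * x" "finite F'" "F \<subseteq> F'"
  shows "x \<approx> \<phi> F' * x"
proof -
  have "\<phi> F' * x \<approx> \<phi> F' * (\<phi> F * x)" by (intro eqv_mult_left assms)
  also have "\<dots> = \<phi> F' * \<phi> F * x" by (simp add: mult.assoc)
  also have "\<dots> \<approx> \<phi> F * x"
    using assms finite_subset by (intro eqv_mult_right \<phi>_mult) auto
  also have "\<dots> \<approx> x" by (rule eqv_sym[OF assms(1)])
  finally show ?thesis by (rule eqv_sym)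
qed

lemma left_span_add: "x \<in> left_span n \<Longrightarrow> y \<in> left_span n \<Longrightarrow> x + y \<in> left_span n"
proof (induction n arbitrary: x y)
  case 0
  then show ?case by (auto intro: diag_add)
next
  case (Suc n)
  obtain F where F: "finite F" "x \<approx> \<phi> F * x" using Suc.prems by auto
  obtain F' where F': "finite F'" "y \<approx> \<phi> F' * y" using Suc.prems by auto
  have "x + y \<approx> \<phi> (F \<union> F') * x + \<phi> (F \<union> F') * y"
    using F F' by (intro eqv_add \<phi>_mono[OF F(2)] \<phi>_mono[OF F'(2)]) auto
  then have "\<exists>G. finite G \<and> x + y \<approx> \<phi> G * (x + y)"
    using F F' by (intro exI[of _ "F \<union> F'"]) (auto simp: distrib_left)
  then show ?case using Suc by (auto simp: distrib_left)
qed

lemma left_span_mult_P: "x \<in> left_span n \<Longrightarrow> p \<in> P \<Longrightarrow> x * p \<in> left_span n"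
proof (induction n arbitrary: x)
  case 0
  then show ?case by (auto intro: diag_mult)
next
  case (Suc n)
  obtain F where F: "finite F" "x \<approx> \<phi> F * x" using Suc.prems by auto
  have "x * p \<approx> \<phi> F * (x * p)" using eqv_mult_right[OF F(2)] by (simp add: mult.assoc)
  then show ?case using F Suc by (auto simp: mult.assoc[symmetric])
qed

lemma left_span_mult_s: "x \<in> left_span n \<Longrightarrow> x * s a \<in> left_span (Suc n)"
proof (induction n arbitrary: x)
  case 0
  then obtain q where q: "q \<in> diag" "x * s a \<approx> s a * q" using diag_shift[of x a] by auto
  have "\<phi> {a} * (s a * q) \<approx> s a * q"
    using eqv_mult_right[OF \<phi>_s[of "{a}" a], of q] by (simp add: mult.assoc)
  then have "\<exists>F. finite F \<and> s a * q \<approx> \<phi> F * (s a * q)"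
    by (intro exI[of _ "{a}"]) (auto intro: eqv_sym)
  moreover have "t b * (s a * q) \<in> left_span 0" for b
  proof (cases "b = a")
    case True
    obtain q' where q': "q' \<in> diag" "t a * x \<approx> q' * t a" using diag_shift[of x a] 0 by auto
    have "q' * (t a * s a) \<in> diag" using q' by (intro diag_mult t_s)
    moreover have "q' * (t a * s a) \<approx> t a * (s a * q)"
    proof -
      have "q' * (t a * s a) \<approx> t a * x * s a"
        using eqv_mult_right[OF eqv_sym[OF q'(2)], of "s a"] by (simp add: mult.assoc)
      also have "\<dots> \<approx> t a * (s a * q)"
        using eqv_mult_left[OF q(2)] by (simp add: mult.assoc)
      finally show ?thesis .
    qed
    ultimately show ?thesis using diag.eqv True by auto
  next
    case False
    then have "t b * (s a * q) \<approx> 0"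
      using eqv_mult_right[OF t_s_neq[of b a], of q] by (simp add: mult.assoc)
    then show ?thesis using diag.eqv[OF diag.zero eqv_sym] by simp
  qed
  ultimately have "s a * q \<in> left_span (Suc 0)" by simp
  then show ?case using left_span_eqv[OF _ eqv_sym[OF q(2)]] by blast
next
  case (Suc n)
  obtain F where F: "finite F" "x \<approx> \<phi> F * x" using Suc.prems by auto
  have "x * s a \<approx> \<phi> F * (x * s a)" using eqv_mult_right[OF F(2)] by (simp add: mult.assoc)
  moreover have "t b * (x * s a) \<in> left_span (Suc n)" for b
    using Suc.IH[of "t b * x"] Suc.prems by (simp add: mult.assoc)
  ultimately show ?case using F(1) unfolding left_span.simps(2)[of "Suc n"] by blast
qed

text \<open>
  As \<open>x\<close> is recovered from the elements \<open>t\<^sub>a x\<close>, one of the products \<open>t\<^sub>a x y\<close> is again nonzero.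
\<close>
lemma left_span_reduce: "x \<in> left_span n \<Longrightarrow> \<not> x * y \<approx> 0 \<Longrightarrow> \<exists>u. u * x \<in> diag \<and> \<not> u * x * y \<approx> 0"
proof (induction n arbitrary: x)
  case 0
  then show ?case by (intro exI[of _ 1]) auto
next
  case (Suc n)
  obtain F where F: "finite F" "x \<approx> \<phi> F * x" using Suc.prems by auto
  have "\<exists>a. \<not> t a * x * y \<approx> 0"
  proof (rule ccontr)
    assume "\<not> (\<exists>a. \<not> t a * x * y \<approx> 0)"
    then have *: "s a * (t a * x * y) \<approx> 0" for a
      using eqv_mult_left[of "t a * x * y" 0 "s a"] by auto
    have "x * y \<approx> \<phi> F * x * y" by (intro eqv_mult_right F)
    also have "\<dots> = (\<Sum>a\<in>F. s a * (t a * x * y))"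
      by (simp add: \<phi>_def sum_distrib_right mult.assoc)
    also have "\<dots> \<approx> (\<Sum>a\<in>F. 0)" by (intro eqv_sum *)
    finally show False using Suc.prems by simp
  qed
  then obtain a where a: "\<not> t a * x * y \<approx> 0" by blast
  then obtain u where "u * (t a * x) \<in> diag" "\<not> u * (t a * x) * y \<approx> 0"
    using Suc.IH[of "t a * x"] Suc.prems by auto
  then show ?case by (intro exI[of _ "u * t a"]) (simp add: mult.assoc)
qed

text \<open>
  Indexing by integers gives the sums of terms \<open>s\<^sub>\<alpha> q\<^sub>\<alpha>\<close> a place in every degree; in negative degrees
  only the zero class is left.
\<close>
definition graded_span :: "int \<Rightarrow> 'r set" where
  "graded_span d = (if d < 0 then J else left_span (nat d))"

lemma graded_span_eqv: "x \<in> graded_span d \<Longrightarrow> x \<approx> y \<Longrightarrow> y \<in> graded_span d"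
  using left_span_eqv eqv_trans[OF eqv_sym, of x y 0] by (auto simp: graded_span_def eqv_zero_iff split: if_splits)

lemma graded_span_zero: "0 \<in> graded_span d"
  by (simp add: graded_span_def zero_mem left_span_zero)

lemma graded_span_add: "x \<in> graded_span d \<Longrightarrow> y \<in> graded_span d \<Longrightarrow> x + y \<in> graded_span d"
  by (auto simp: graded_span_def add_mem left_span_add split: if_splits)

lemma graded_span_mult_P: "x \<in> graded_span d \<Longrightarrow> p \<in> P \<Longrightarrow> x * p \<in> graded_span d"
  by (auto simp: graded_span_def mult_right_mem left_span_mult_P split: if_splits)

lemma graded_span_mult_s: assumes "x \<in> graded_span d" shows "x * s a \<in> graded_span (d + 1)"
proof (cases "d < 0")
  case True
  then have "x * s a \<approx> 0" using assms by (simp add: graded_span_def mult_right_mem eqv_zero_iff)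
  then show ?thesis using graded_span_eqv[OF graded_span_zero eqv_sym] by blast
next
  case False
  then have "nat (d + 1) = Suc (nat d)" by simp
  then show ?thesis using left_span_mult_s[of x "nat d" a] assms False unfolding graded_span_def by simp
qed

subsection \<open>Combinations of monomials\<close>

text \<open>
  The sums of monomials \<open>s\<^sub>\<alpha> q t\<^sub>\<beta>\<close> of degree \<open>d = |\<alpha>| - |\<beta>|\<close> with \<open>|\<beta>| \<le> m\<close>, again described by
  the effect of multiplication: writing such a sum as \<open>w + \<Sum>\<^sub>a x\<^sub>a t\<^sub>a\<close> with \<open>a\<close> ranging over \<open>F\<close>, the factor
  \<open>1 - \<phi> F\<close> kills the terms \<open>x\<^sub>a t\<^sub>a\<close>, while multiplication by \<open>s\<^sub>a\<close> shortens every \<open>\<beta>\<close>.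
\<close>
fun monomials :: "nat \<Rightarrow> int \<Rightarrow> 'r set" where
  "monomials 0 d = graded_span d"
| "monomials (Suc m) d = {x. (\<exists>F. \<exists>w\<in>graded_span d. finite F \<and> x * (1 - \<phi> F) \<approx> w * (1 - \<phi> F)) \<and>
    (\<forall>a. x * s a \<in> monomials m (d + 1))}"

lemma monomials_eqv: "x \<in> monomials m d \<Longrightarrow> x \<approx> y \<Longrightarrow> y \<in> monomials m d"
proof (induction m arbitrary: x y d)
  case 0
  then show ?case by (auto intro: graded_span_eqv)
next
  case (Suc m)
  then obtain F w where F: "finite F" "w \<in> graded_span d" "x * (1 - \<phi> F) \<approx> w * (1 - \<phi> F)" by auto
  have "y * (1 - \<phi> F) \<approx> w * (1 - \<phi> F)"
    using F(3) eqv_mult_right[OF eqv_sym[OF Suc.prems(2)]] eqv_trans by blast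
  moreover have "y * s a \<in> monomials m (d + 1)" for a
    using Suc.prems Suc.IH[OF _ eqv_mult_right[OF Suc.prems(2)]] by simp
  ultimately show ?case using F by auto
qed

lemma monomials_zero: "0 \<in> monomials m d"
  by (induction m arbitrary: d) (auto simp: graded_span_zero intro!: bexI[of _ 0])

lemma monomials_Suc: "x \<in> monomials m d \<Longrightarrow> x \<in> monomials (Suc m) d"
proof (induction m arbitrary: x d)
  case 0
  then show ?case using graded_span_mult_s by (auto intro!: bexI[of _ x] exI[of _ "{}"])
next
  case (Suc m)
  have "x * s a \<in> monomials (Suc m) (d + 1)" for a
    using Suc.prems by (intro Suc.IH) simp
  moreover have "\<exists>F. \<exists>w\<in>graded_span d. finite F \<and> x * (1 - \<phi> F) \<approx> w * (1 - \<phi> F)"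
    using Suc.prems by simp
  ultimately show ?case
    unfolding monomials.simps(2)[of "Suc m"] by blast
qed

lemma monomials_mono: "m \<le> n \<Longrightarrow> x \<in> monomials m d \<Longrightarrow> x \<in> monomials n d"
  by (induction n rule: dec_induct) (simp_all only: monomials_Suc)

lemma monomials_compl_mono:
  assumes "x * (1 - \<phi> F) \<approx> w * (1 - \<phi> F)" "finite F'" "F \<subseteq> F'"
  shows "x * (1 - \<phi> F') \<approx> w * (1 - \<phi> F')"
proof -
  have *: "(1 - \<phi> F) * (1 - \<phi> F') \<approx> 1 - \<phi> F'"
    using assms finite_subset by (intro compl_\<phi>_mult) auto
  have "x * (1 - \<phi> F') \<approx> x * ((1 - \<phi> F) * (1 - \<phi> F'))" by (rule eqv_mult_left[OF eqv_sym[OF *]])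
  also have "\<dots> = x * (1 - \<phi> F) * (1 - \<phi> F')" by (simp only: mult.assoc)
  also have "\<dots> \<approx> w * (1 - \<phi> F) * (1 - \<phi> F')" by (intro eqv_mult_right assms)
  also have "\<dots> = w * ((1 - \<phi> F) * (1 - \<phi> F'))" by (simp only: mult.assoc)
  also have "\<dots> \<approx> w * (1 - \<phi> F')" by (intro eqv_mult_left *)
  finally show ?thesis .
qed

lemma monomials_add: "x \<in> monomials m d \<Longrightarrow> y \<in> monomials m d \<Longrightarrow> x + y \<in> monomials m d"
proof (induction m arbitrary: x y d)
  case 0
  then show ?case by (auto intro: graded_span_add)
next
  case (Suc m)
  obtain F w where F: "finite F" "w \<in> graded_span d" "x * (1 - \<phi> F) \<approx> w * (1 - \<phi> F)" using Suc.prems by auto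
  obtain F' w' where F': "finite F'" "w' \<in> graded_span d" "y * (1 - \<phi> F') \<approx> w' * (1 - \<phi> F')"
    using Suc.prems by auto
  let ?G = "F \<union> F'"
  have "x * (1 - \<phi> ?G) + y * (1 - \<phi> ?G) \<approx> w * (1 - \<phi> ?G) + w' * (1 - \<phi> ?G)"
    using F F' by (intro eqv_add monomials_compl_mono[OF F(3)] monomials_compl_mono[OF F'(3)]) auto
  then have "\<exists>F. \<exists>v\<in>graded_span d. finite F \<and> (x + y) * (1 - \<phi> F) \<approx> v * (1 - \<phi> F)"
    using F F' by (intro exI[of _ ?G] bexI[of _ "w + w'"]) (auto simp: distrib_right graded_span_add)
  moreover have "(x + y) * s a \<in> monomials m (d + 1)" for a
    using Suc by (auto simp: distrib_right)
  ultimately show ?case by simp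
qed

text \<open>
  Closure under right multiplication by the three kinds of generators makes every word in them a
  member, since words are built up from the left.
\<close>
lemma monomials_mult_P: "x \<in> monomials m d \<Longrightarrow> p \<in> P \<Longrightarrow> x * p \<in> monomials m d"
proof (induction m arbitrary: x p d)
  case 0
  then show ?case by (auto intro: graded_span_mult_P)
next
  case (Suc m)
  obtain F w where F: "finite F" "w \<in> graded_span d" "x * (1 - \<phi> F) \<approx> w * (1 - \<phi> F)" using Suc.prems by auto
  note comm = compl_\<phi>_commute[OF Suc.prems(2), of F]
  have "x * p * (1 - \<phi> F) \<approx> x * (1 - \<phi> F) * p"
    using eqv_mult_left[OF comm, of x] by (simp only: mult.assoc)
  also have "\<dots> \<approx> w * (1 - \<phi> F) * p" by (intro eqv_mult_right F)
  also have "\<dots> \<approx> w * p * (1 - \<phi> F)"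
    using eqv_mult_left[OF eqv_sym[OF comm], of w] by (simp only: mult.assoc)
  finally have "\<exists>F. \<exists>v\<in>graded_span d. finite F \<and> x * p * (1 - \<phi> F) \<approx> v * (1 - \<phi> F)"
    using F graded_span_mult_P[OF F(2) Suc.prems(2)] by blast
  moreover have "x * p * s a \<in> monomials m (d + 1)" for a
  proof -
    obtain q where q: "q \<in> P" "p * s a \<approx> s a * q" using P_shift[OF Suc.prems(2)] by blast
    have "x * s a * q \<in> monomials m (d + 1)" using Suc q by simp
    moreover have "x * s a * q \<approx> x * p * s a"
      using eqv_mult_left[OF eqv_sym[OF q(2)], of x] by (simp only: mult.assoc)
    ultimately show ?thesis by (rule monomials_eqv)
  qed
  ultimately show ?case by simp
qed

lemma monomials_mult_s: "x \<in> monomials m d \<Longrightarrow> x * s a \<in> monomials m (d + 1)"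
proof (cases m)
  case (Suc n)
  moreover assume "x \<in> monomials m d"
  ultimately have "x * s a \<in> monomials n (d + 1)" by simp
  then show ?thesis unfolding Suc by (rule monomials_Suc)
qed (simp add: graded_span_mult_s)

lemma monomials_mult_t: assumes "x \<in> monomials m d" shows "x * t a \<in> monomials (Suc m) (d - 1)"
proof -
  have "x * t a * (1 - \<phi> {a}) \<approx> 0 * (1 - \<phi> {a})"
    using eqv_mult_left[OF eqv_diff[OF eqv_refl t_\<phi>[of "{a}" a], of "t a"], of x]
    by (simp add: algebra_simps)
  then have "\<exists>F. \<exists>v\<in>graded_span (d - 1). finite F \<and> x * t a * (1 - \<phi> F) \<approx> v * (1 - \<phi> F)"
    using graded_span_zero by blast
  moreover have "x * t a * s b \<in> monomials m d" for b
  proof (cases "a = b")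
    case True
    then show ?thesis using monomials_mult_P[OF assms t_s] by (simp add: mult.assoc)
  next
    case False
    have "x * (t a * s b) \<approx> x * 0" by (intro eqv_mult_left t_s_neq False)
    then show ?thesis using monomials_eqv[OF monomials_zero eqv_sym] by (simp add: mult.assoc)
  qed
  ultimately show ?thesis by simp
qed

text \<open>
  Either some \<open>x s\<^sub>a\<close> is nonzero and has shorter ghost parts, or \<open>x \<phi> F = 0\<close>, in which case \<open>x\<close> equals
  \<open>x (1 - \<phi> F) = w (1 - \<phi> F)\<close>.
\<close>
lemma monomials_reduce:
  "x \<in> monomials m d \<Longrightarrow> \<not> x \<approx> 0 \<Longrightarrow>
    \<exists>v F n. \<exists>w\<in>left_span n. finite F \<and> x * v \<approx> w * (1 - \<phi> F) \<and> \<not> x * v \<approx> 0"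
proof (induction m arbitrary: x d)
  case 0
  then have "x \<in> left_span (nat d)" by (auto simp: graded_span_def eqv_zero_iff split: if_splits)
  then show ?case
    using 0 by (intro exI[of _ 1] exI[of _ "{}"] exI[of _ "nat d"] bexI[of _ x]) (auto simp: \<phi>_def)
next
  case (Suc m)
  show ?case
  proof (cases "\<exists>a. \<not> x * s a \<approx> 0")
    case True
    then obtain a where a: "\<not> x * s a \<approx> 0" by blast
    then obtain v F n w where "w \<in> left_span n" "finite F" "x * s a * v \<approx> w * (1 - \<phi> F)" "\<not> x * s a * v \<approx> 0"
      using Suc.IH[of "x * s a" "d + 1"] Suc.prems by auto
    then show ?thesis
      by (intro exI[of _ "s a * v"] exI[of _ F] exI[of _ n] bexI[of _ w]) (simp_all add: mult.assoc)
  next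
    case False
    obtain F w where F: "finite F" "w \<in> graded_span d" "x * (1 - \<phi> F) \<approx> w * (1 - \<phi> F)"
      using Suc.prems by auto
    have "x * \<phi> F = (\<Sum>a\<in>F. x * s a * t a)"
      by (simp add: \<phi>_def sum_distrib_left mult.assoc)
    also have "\<dots> \<approx> (\<Sum>a\<in>F. 0 * t a)" using False by (intro eqv_sum eqv_mult_right) auto
    finally have "x - x * \<phi> F \<approx> x - 0" by (intro eqv_diff eqv_refl) simp
    then have x: "x \<approx> x * (1 - \<phi> F)" using eqv_sym by (simp add: algebra_simps)
    then have xw: "x \<approx> w * (1 - \<phi> F)" using F eqv_trans by blast
    have "\<not> d < 0"
    proof
      assume "d < 0"
      then have "w * (1 - \<phi> F) \<approx> 0" using F by (simp add: graded_span_def eqv_zero_iff mult_right_mem)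
      then show False using xw Suc.prems eqv_trans by blast
    qed
    then have "w \<in> left_span (nat d)" using F by (simp add: graded_span_def)
    then show ?thesis using xw F Suc.prems
      by (intro exI[of _ 1] exI[of _ F] exI[of _ "nat d"] bexI[of _ w]) auto
  qed
qed

text \<open>
  Compression to a nonzero multiple \<open>u x v\<close> of an idempotent shows that \<open>x v u x\<close> cannot vanish, as
  otherwise \<open>u x v\<close> would square to zero.
\<close>
lemma monomials_nondegenerate:
  assumes "x \<in> monomials m d" "\<not> x \<approx> 0"
  shows "\<exists>y. \<not> x * y * x \<approx> 0"
proof -
  obtain v F n w where w: "w \<in> left_span n" "finite F" "x * v \<approx> w * (1 - \<phi> F)" "\<not> x * v \<approx> 0"
    using monomials_reduce[OF assms] by blast
  define f where "f = 1 - \<phi> F"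
  have "\<not> w * f \<approx> 0" using w eqv_trans unfolding f_def by blast
  then obtain u where u: "u * w \<in> diag" "\<not> u * w * f \<approx> 0" using left_span_reduce[OF w(1)] by blast
  have ff: "f * f \<approx> f" unfolding f_def using w by (intro compl_\<phi>_mult) auto
  have pf: "p * f \<approx> f * p" if "p \<in> P" for p unfolding f_def using that by (rule compl_\<phi>_commute)
  obtain c e where e: "e * e \<approx> e" "f * e \<approx> e" "u * w * e \<approx> k c * e" "\<not> k c * e \<approx> 0"
    using diag_scalar_corner[OF u(1) ff pf, of 0] u(2) by (auto simp: k_zero)
  have uxv: "u * x * (v * e) \<approx> k c * e"
  proof -
    have "u * x * (v * e) \<approx> u * (w * f) * e"
      using eqv_mult_right[OF eqv_mult_left[OF w(3)], of u e] by (simp add: mult.assoc f_def)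
    also have "\<dots> = u * w * (f * e)" by (simp add: mult.assoc)
    also have "\<dots> \<approx> u * w * e" by (intro eqv_mult_left e)
    also have "\<dots> \<approx> k c * e" by (rule e)
    finally show ?thesis .
  qed
  have "c \<noteq> 0" using e(4) by (auto simp: k_zero)
  have "\<not> x * (v * e * u) * x \<approx> 0"
  proof
    assume "x * (v * e * u) * x \<approx> 0"
    then have "u * (x * (v * e * u) * x) * (v * e) \<approx> u * 0 * (v * e)"
      by (intro eqv_mult_right eqv_mult_left)
    then have 0: "(u * x * (v * e)) * (u * x * (v * e)) \<approx> 0" by (simp add: mult.assoc)
    have "k c * e \<approx> k c * (e * e)" by (rule eqv_mult_left[OF eqv_sym[OF e(1)]])
    also have "\<dots> = k (inverse c) * ((k c * e) * (k c * e))"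
    proof -
      have "k (inverse c) * ((k c * e) * (k c * e)) = k (inverse c) * k c * (e * k c) * e"
        by (simp add: mult.assoc)
      also have "\<dots> = k (inverse c * c) * (k c * e) * e"
        by (simp add: k_mult k_central[of c e, symmetric] mult.assoc)
      finally show ?thesis using \<open>c \<noteq> 0\<close> by (simp add: k_one mult.assoc)
    qed
    also have "\<dots> \<approx> k (inverse c) * ((u * x * (v * e)) * (u * x * (v * e)))"
      by (intro eqv_mult_left eqv_mult eqv_sym[OF uxv])
    also have "\<dots> \<approx> k (inverse c) * 0" by (intro eqv_mult_left 0)
    finally show False using e(4) by simp
  qed
  then show ?thesis by blast
qed

end

section \<open>Restriction of polynomials to sets of words\<close>

lemma poly_mapping_additive_induct [case_names zero add]:
  fixes f :: "'b \<Rightarrow>\<^sub>0 'c::comm_monoid_add"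
  assumes "Q 0" and "\<And>w c f. Q f \<Longrightarrow> Q (Poly_Mapping.single w c + f)"
  shows "Q f"
proof (induction f rule: update_induct)
  case (update f a b)
  then have "Poly_Mapping.update a b f = Poly_Mapping.single a b + f"
    by (intro poly_mapping_eqI)
      (auto simp: lookup_update lookup_add lookup_single in_keys_iff when_def)
  then show ?case
    using update.IH assms(2) by simp
qed (rule assms(1))

definition restrict_keys :: "'b set \<Rightarrow> ('b \<Rightarrow>\<^sub>0 'c::zero) \<Rightarrow> 'b \<Rightarrow>\<^sub>0 'c" where
  "restrict_keys X f = Poly_Mapping.mapp (\<lambda>w c. c when w \<in> X) f"

lemma lookup_restrict_keys: "Poly_Mapping.lookup (restrict_keys X f) w = (Poly_Mapping.lookup f w when w \<in> X)"
  by (auto simp: restrict_keys_def lookup_mapp when_def in_keys_iff)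

lemma keys_restrict_keys [simp]: "Poly_Mapping.keys (restrict_keys X f) = Poly_Mapping.keys f \<inter> X"
  by (auto simp: in_keys_iff lookup_restrict_keys)

lemma restrict_keys_zero [simp]: "restrict_keys X 0 = 0"
  by (rule poly_mapping_eqI) (simp add: lookup_restrict_keys)

lemma restrict_keys_add:
  "restrict_keys X (f + g) = restrict_keys X f + restrict_keys X (g :: 'b \<Rightarrow>\<^sub>0 'c::monoid_add)"
  by (rule poly_mapping_eqI) (auto simp: lookup_restrict_keys lookup_add when_def)

lemma restrict_keys_single:
  "restrict_keys X (Poly_Mapping.single w c) = (if w \<in> X then Poly_Mapping.single w c else 0)"
  by (rule poly_mapping_eqI) (auto simp: lookup_restrict_keys lookup_single when_def)

lemma restrict_keys_commute:
  "restrict_keys X (restrict_keys Y f) = restrict_keys Y (restrict_keys X f)"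
  by (rule poly_mapping_eqI) (auto simp: lookup_restrict_keys when_def)

lemma restrict_keys_id: "Poly_Mapping.keys f \<subseteq> X \<Longrightarrow> restrict_keys X f = f"
  by (rule poly_mapping_eqI) (auto simp: lookup_restrict_keys when_def in_keys_iff)

lemma restrict_keys_eq_zero: "Poly_Mapping.keys f \<inter> X = {} \<Longrightarrow> restrict_keys X f = 0"
  by (rule poly_mapping_eqI) (auto simp: lookup_restrict_keys when_def in_keys_iff)

text \<open>
  If the complement of \<open>X\<close> is absorbing under concatenation, then the words outside \<open>X\<close> span an ideal
  complementary to the subalgebra on \<open>X\<close>, and restriction is the projection along it.
\<close>
lemma restrict_keys_mult:
  fixes f g :: "'b::monoid_add \<Rightarrow>\<^sub>0 'c::ring_1"
  assumes "\<And>v w. v + w \<in> X \<longleftrightarrow> v \<in> X \<and> w \<in> X"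
  shows "restrict_keys X (f * g) = restrict_keys X f * restrict_keys X g"
proof (induction f rule: poly_mapping_additive_induct)
  case (add v c f)
  have "restrict_keys X (Poly_Mapping.single v c * g) =
      restrict_keys X (Poly_Mapping.single v c) * restrict_keys X g"
    by (induction g rule: poly_mapping_additive_induct)
      (auto simp: distrib_left restrict_keys_add restrict_keys_single mult_single assms)
  then show ?case
    using add by (simp add: distrib_right restrict_keys_add)
qed simp

lemma single_zero_central:
  fixes f :: "'b::monoid_add \<Rightarrow>\<^sub>0 'k::comm_ring_1"
  shows "f * Poly_Mapping.single 0 c = Poly_Mapping.single 0 c * f"
  by (induction f rule: poly_mapping_additive_induct)
    (simp_all add: distrib_left distrib_right mult_single mult.commute)

section \<open>The grading by degree\<close>

fun letter_degree :: "('v, 'a) lpa_gen \<Rightarrow> int" where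
  "letter_degree (Proj A) = 0"
| "letter_degree (Edge a) = 1"
| "letter_degree (Ghost a) = - 1"

definition word_degree :: "('v, 'a) lpa_gen free_word \<Rightarrow> int" where
  "word_degree w = sum_list (map letter_degree (letters w))"

lemma word_degree_plus: "word_degree (v + w) = word_degree v + word_degree w"
  by (simp add: word_degree_def plus_free_word_def)

definition component :: "int \<Rightarrow> ('v, 'a, 'k::field) lpa_free \<Rightarrow> ('v, 'a, 'k) lpa_free" where
  "component d = restrict_keys {w. word_degree w = d}"

lemma component_zero [simp]: "component d 0 = 0"
  by (simp add: component_def)

lemma component_add: "component d (f + g) = component d f + component d g"
  by (simp add: component_def restrict_keys_add)

lemma component_single_mult:
  "component d (Poly_Mapping.single w c * f) =
    Poly_Mapping.single w c * component (d - word_degree w) f"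
proof (induction f rule: poly_mapping_additive_induct)
  case (add v c' f)
  have "component d (Poly_Mapping.single w c * Poly_Mapping.single v c') =
    Poly_Mapping.single w c * component (d - word_degree w) (Poly_Mapping.single v c')"
    by (auto simp: component_def mult_single restrict_keys_single word_degree_plus)
  then show ?case
    using add by (simp add: distrib_left component_add)
qed simp

lemma component_mult_single:
  "component d (f * Poly_Mapping.single w c) =
    component (d - word_degree w) f * Poly_Mapping.single w c"
proof (induction f rule: poly_mapping_additive_induct)
  case (add v c' f)
  have "component d (Poly_Mapping.single v c' * Poly_Mapping.single w c) =
    component (d - word_degree w) (Poly_Mapping.single v c') * Poly_Mapping.single w c"
    by (auto simp: component_def mult_single restrict_keys_single word_degree_plus)
  then show ?case
    using add by (simp add: distrib_right component_add)
qed simp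

definition homogeneous :: "int \<Rightarrow> ('v, 'a, 'k::field) lpa_free \<Rightarrow> bool" where
  "homogeneous d f \<longleftrightarrow> Poly_Mapping.keys f \<subseteq> {w. word_degree w = d}"

lemma component_homogeneous:
  "homogeneous d f \<Longrightarrow> component e f = (if e = d then f else 0)"
  by (auto simp: homogeneous_def component_def intro!: restrict_keys_id restrict_keys_eq_zero)

lemma homogeneous_zero: "homogeneous d 0"
  by (simp add: homogeneous_def)

lemma homogeneous_add: "homogeneous d f \<Longrightarrow> homogeneous d g \<Longrightarrow> homogeneous d (f + g)"
  using keys_add[of f g] by (auto simp: homogeneous_def)

lemma homogeneous_diff: "homogeneous d f \<Longrightarrow> homogeneous d g \<Longrightarrow> homogeneous d (f - g)"
  using keys_diff[of f g] by (auto simp: homogeneous_def)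

lemma homogeneous_sum: "(\<And>i. i \<in> X \<Longrightarrow> homogeneous d (f i)) \<Longrightarrow> homogeneous d (sum f X)"
  by (induction X rule: infinite_finite_induct) (auto intro: homogeneous_zero homogeneous_add)

lemma homogeneous_mult:
  "homogeneous d f \<Longrightarrow> homogeneous e g \<Longrightarrow> homogeneous (d + e) (f * g)"
  using keys_mult[of f g] by (fastforce simp: homogeneous_def word_degree_plus)

lemma homogeneous_free_gen: "homogeneous (letter_degree g) (free_gen g)"
  by (simp add: homogeneous_def free_gen_def word_degree_def)

lemma lpa_relation_homogeneous:
  assumes "lpa_relation E lab B x y"
  shows "\<exists>d. homogeneous d (x - y)"
proof -
  note gen = homogeneous_free_gen[of "Proj _", simplified] homogeneous_free_gen[of "Edge _", simplified]
    homogeneous_free_gen[of "Ghost _", simplified]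
  have pp: "homogeneous 0 (lpa_p A * lpa_p C)" for A C :: "'a set"
    using homogeneous_mult[OF gen(1) gen(1)] by simp
  have ps: "homogeneous 1 (lpa_p A * lpa_s a)" "homogeneous 1 (lpa_s a * lpa_p A)"
    "homogeneous (-1) (lpa_s_star a * lpa_p A)" "homogeneous (-1) (lpa_p A * lpa_s_star a)"
    for A :: "'a set" and a :: 'c
    using homogeneous_mult[OF gen(1) gen(2)] homogeneous_mult[OF gen(2) gen(1)]
      homogeneous_mult[OF gen(1) gen(3)] homogeneous_mult[OF gen(3) gen(1)] by simp_all
  have ss: "homogeneous 0 (lpa_s_star a * lpa_s b)" "homogeneous 0 (lpa_s a * lpa_s_star b)" for a b :: 'c
    using homogeneous_mult[OF gen(3) gen(2)] homogeneous_mult[OF gen(2) gen(3)] by simp_all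
  have sss: "homogeneous 1 (lpa_s a * lpa_s_star b * lpa_s c)"
    "homogeneous (-1) (lpa_s_star a * lpa_s b * lpa_s_star c)"
    "homogeneous 0 (lpa_s a * lpa_p A * lpa_s_star c)" for a b c :: 'c and A :: "'a set"
    using homogeneous_mult[OF ss(2) gen(2)] homogeneous_mult[OF ss(1) gen(3)]
      homogeneous_mult[OF ps(2) gen(3)] by simp_all
  show ?thesis
    using assms
    by cases (blast intro: homogeneous_zero homogeneous_add homogeneous_diff homogeneous_sum gen pp ps ss sss)+
qed

lemma keys_mult_degree_le:
  assumes "Poly_Mapping.keys f \<subseteq> {w. word_degree w \<le> a}" "Poly_Mapping.keys g \<subseteq> {w. word_degree w \<le> b}"
  shows "Poly_Mapping.keys (f * g) \<subseteq> {w. word_degree w \<le> a + b}"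
proof
  fix u assume "u \<in> Poly_Mapping.keys (f * g)"
  then obtain v w where "u = v + w" "v \<in> Poly_Mapping.keys f" "w \<in> Poly_Mapping.keys g"
    using keys_mult[of f g] by blast
  then show "u \<in> {w. word_degree w \<le> a + b}"
    using assms by (auto simp: word_degree_plus intro: add_mono)
qed

section \<open>The ideal of relations\<close>

context normal_labelled_space
begin

abbreviation G where "G \<equiv> lpa_generators E lab B"

definition lpa_ideal :: "('v, 'a, 'k::field) lpa_free set" where
  "lpa_ideal = generated_ideal (free_algebra G) {x - y | x y. lpa_relation E lab B x y}"

lemma relators_in_carrier:
  "{x - y | x y :: ('v, 'a, 'k::field) lpa_free. lpa_relation E lab B x y} \<subseteq> carrier (free_algebra G)"
proof -
  have "x - y \<in> carrier (free_algebra G)"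
    if "x \<in> carrier (free_algebra G)" "y \<in> carrier (free_algebra G)" for x y :: "('v, 'a, 'k) lpa_free"
    using that keys_diff[of x y] by (auto simp: free_algebra_def)
  then show ?thesis using lpa_relation_in_carrier by blast
qed

lemma lpa_ideal_algebra_ideal:
  "algebra_ideal (lpa_ideal :: ('v, 'a, 'k::field) lpa_free set) (free_algebra G)"
proof -
  interpret F: nonunital_algebra "free_algebra G :: ('k, ('v, 'a, 'k) lpa_free) module"
    by (rule free_algebra_nonunital_algebra)
  show ?thesis
    unfolding lpa_ideal_def by (rule F.generated_ideal_algebra_ideal[OF relators_in_carrier])
qed

lemma
  fixes x y :: "('v, 'a, 'k::field) lpa_free"
  shows lpa_ideal_carrier: "x \<in> lpa_ideal \<Longrightarrow> x \<in> carrier (free_algebra G)"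
    and lpa_ideal_zero: "(0 :: ('v, 'a, 'k) lpa_free) \<in> lpa_ideal"
    and lpa_ideal_add: "x \<in> lpa_ideal \<Longrightarrow> y \<in> lpa_ideal \<Longrightarrow> x + y \<in> lpa_ideal"
    and lpa_ideal_left: "x \<in> lpa_ideal \<Longrightarrow> y \<in> carrier (free_algebra G) \<Longrightarrow> y * x \<in> lpa_ideal"
    and lpa_ideal_right: "x \<in> lpa_ideal \<Longrightarrow> y \<in> carrier (free_algebra G) \<Longrightarrow> x * y \<in> lpa_ideal"
    and lpa_ideal_scale: "x \<in> lpa_ideal \<Longrightarrow> Poly_Mapping.single 0 c * x \<in> lpa_ideal"
    and lpa_ideal_relator: "lpa_relation E lab B x y \<Longrightarrow> x - y \<in> lpa_ideal"
proof -
  interpret J: algebra_ideal "lpa_ideal :: ('v, 'a, 'k) lpa_free set" "free_algebra G"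
    by (rule lpa_ideal_algebra_ideal)
  have sel: "mult (free_algebra G) = (*)" "add (free_algebra G) = (+)" "zero (free_algebra G) = 0"
    "smult (free_algebra G) = (\<lambda>c f. Poly_Mapping.single 0 c * f)"
    by (simp_all add: free_algebra_def mult_map_scale_conv_mult fun_eq_iff)
  show "x \<in> lpa_ideal \<Longrightarrow> x \<in> carrier (free_algebra G)" by (rule J.a_Hcarr)
  show "(0 :: ('v, 'a, 'k) lpa_free) \<in> lpa_ideal"
    using additive_subgroup.zero_closed[OF J.additive_subgroup_axioms] unfolding sel .
  show "x \<in> lpa_ideal \<Longrightarrow> y \<in> lpa_ideal \<Longrightarrow> x + y \<in> lpa_ideal"
    using additive_subgroup.a_closed[OF J.additive_subgroup_axioms] unfolding sel .
  show "x \<in> lpa_ideal \<Longrightarrow> y \<in> carrier (free_algebra G) \<Longrightarrow> y * x \<in> lpa_ideal"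
    using J.I_l_closed unfolding sel .
  show "x \<in> lpa_ideal \<Longrightarrow> y \<in> carrier (free_algebra G) \<Longrightarrow> x * y \<in> lpa_ideal"
    using J.I_r_closed unfolding sel .
  show "x \<in> lpa_ideal \<Longrightarrow> Poly_Mapping.single 0 c * x \<in> lpa_ideal"
    using J.I_smult_closed unfolding sel .
  show "lpa_relation E lab B x y \<Longrightarrow> x - y \<in> lpa_ideal"
    by (auto simp: lpa_ideal_def generated_ideal_def)
qed

lemma lpa_ideal_least:
  assumes "algebra_ideal I (free_algebra G)" "\<And>x y. lpa_relation E lab B x y \<Longrightarrow> x - y \<in> I"
  shows "lpa_ideal \<subseteq> I"
  unfolding lpa_ideal_def generated_ideal_def using assms by blast

lemma lpa_ideal_word:
  fixes x :: "('v, 'a, 'k::field) lpa_free"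
  assumes "x \<in> lpa_ideal" "set (letters w) \<subseteq> G"
  shows "Poly_Mapping.single w c * x \<in> lpa_ideal" and "x * Poly_Mapping.single w c \<in> lpa_ideal"
proof -
  have "Poly_Mapping.single w c * x \<in> lpa_ideal \<and> x * Poly_Mapping.single w c \<in> lpa_ideal"
  proof (cases "w = 0")
    case True
    then show ?thesis using assms by (simp add: single_zero_central lpa_ideal_scale)
  next
    case False
    then have "letters w \<noteq> []" by (cases w) (simp add: zero_free_word_def)
    then have "Poly_Mapping.single w c \<in> carrier (free_algebra G)"
      using assms(2) by (auto simp: free_algebra_def split: if_splits)
    then show ?thesis using assms(1) lpa_ideal_left lpa_ideal_right by blast
  qed
  then show "Poly_Mapping.single w c * x \<in> lpa_ideal" and "x * Poly_Mapping.single w c \<in> lpa_ideal"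
    by auto
qed

text \<open>
  The ring homomorphism that sends the letters outside the generators to zero. Its image is the free
  algebra with unit on the generators.
\<close>
definition retract :: "('v, 'a, 'k::field) lpa_free \<Rightarrow> ('v, 'a, 'k) lpa_free" where
  "retract = restrict_keys {w. set (letters w) \<subseteq> G}"

lemma retract_mult: "retract (f * g) = retract f * retract g"
  unfolding retract_def by (rule restrict_keys_mult) (auto simp: plus_free_word_def)

lemma retract_carrier: "f \<in> carrier (free_algebra G) \<Longrightarrow> retract f = f"
  unfolding retract_def by (rule restrict_keys_id) (auto simp: free_algebra_def)

lemma component_retract_mult:
  fixes x :: "('v, 'a, 'k::field) lpa_free"
  assumes "\<And>d. component d x \<in> lpa_ideal"
  shows "component d (retract z * x) \<in> lpa_ideal" and "component d (x * retract z) \<in> lpa_ideal"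
proof -
  have "component d (retract z * x) \<in> lpa_ideal \<and> component d (x * retract z) \<in> lpa_ideal"
  proof (induction z rule: poly_mapping_additive_induct)
    case zero
    then show ?case by (simp add: retract_def lpa_ideal_zero)
  next
    case (add w c z)
    then show ?case
      using assms
      by (auto simp: retract_def restrict_keys_add restrict_keys_single distrib_left distrib_right
          component_add component_single_mult component_mult_single intro!: lpa_ideal_add lpa_ideal_word)
  qed
  then show "component d (retract z * x) \<in> lpa_ideal" and "component d (x * retract z) \<in> lpa_ideal"
    by auto
qed

lemma lpa_ideal_retract_mult:
  fixes x :: "('v, 'a, 'k::field) lpa_free"
  assumes "x \<in> lpa_ideal"
  shows "retract z * x \<in> lpa_ideal" and "x * retract z \<in> lpa_ideal"
proof -
  have "retract z * x \<in> lpa_ideal \<and> x * retract z \<in> lpa_ideal"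
  proof (induction z rule: poly_mapping_additive_induct)
    case zero
    then show ?case by (simp add: retract_def lpa_ideal_zero)
  next
    case (add w c z)
    then show ?case
      using assms
      by (auto simp: retract_def restrict_keys_add restrict_keys_single distrib_left distrib_right
          intro!: lpa_ideal_add lpa_ideal_word)
  qed
  then show "retract z * x \<in> lpa_ideal" and "x * retract z \<in> lpa_ideal"
    by auto
qed

text \<open>
  The ideal is graded because homogeneous elements generate it: the elements all of whose components
  lie in the ideal form an ideal containing the relators.
\<close>
lemma lpa_ideal_component:
  fixes x :: "('v, 'a, 'k::field) lpa_free"
  assumes "x \<in> lpa_ideal"
  shows "component d x \<in> lpa_ideal"
proof -
  let ?F = "free_algebra G :: ('k, ('v, 'a, 'k) lpa_free) module"
  define I :: "('v, 'a, 'k) lpa_free set" where "I = {x \<in> lpa_ideal. \<forall>d. component d x \<in> lpa_ideal}"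
  interpret F: nonunital_algebra ?F by (rule free_algebra_nonunital_algebra)
  have sel: "mult ?F = (*)" "add ?F = (+)" "zero ?F = 0"
    "smult ?F = (\<lambda>c f. Poly_Mapping.single 0 c * f)"
    by (simp_all add: free_algebra_def mult_map_scale_conv_mult fun_eq_iff)
  have carr: "x \<in> carrier ?F" if "x \<in> I" for x
    using that lpa_ideal_carrier by (auto simp: I_def)
  have scale: "Poly_Mapping.single 0 c * x \<in> I" if "x \<in> I" for c x
    using that lpa_ideal_word[of _ 0 c] by (simp add: I_def component_single_mult zero_free_word_def)
  have add: "x + y \<in> I" if "x \<in> I" "y \<in> I" for x y
    using that by (simp add: I_def component_add lpa_ideal_add)
  have neg: "- x \<in> I" if "x \<in> I" for x
    using scale[OF that, of "-1"] by (simp add: single_uminus)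
  have mult: "z * x \<in> I" "x * z \<in> I" if "x \<in> I" "z \<in> carrier ?F" for x z
    using that component_retract_mult[of x _ z] lpa_ideal_left[of x z] lpa_ideal_right[of x z]
    by (simp_all add: I_def retract_carrier)
  have "subgroup I (add_monoid ?F)"
  proof (rule F.add.subgroupI)
    show "I \<subseteq> carrier ?F" using carr by blast
    show "I \<noteq> {}" using lpa_ideal_zero unfolding I_def by auto
    show "\<ominus>\<^bsub>?F\<^esub> a \<in> I" if "a \<in> I" for a
    proof -
      have "\<ominus>\<^bsub>?F\<^esub> a = - a"
        using carr[OF that] carr[OF neg[OF that]] by (intro F.minus_equality) (simp_all add: sel)
      then show ?thesis using neg[OF that] by simp
    qed
    show "a \<oplus>\<^bsub>?F\<^esub> b \<in> I" if "a \<in> I" "b \<in> I" for a b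
      using add[OF that] by (simp add: sel)
  qed
  then have "algebra_ideal I ?F"
    by (intro algebra_ideal.intro ring_ideal.intro additive_subgroup.intro ring_ideal_axioms.intro
        algebra_ideal_axioms.intro F.nonunital_algebra_axioms F.nonunital_ring_axioms, unfold sel)
      (rule mult scale | assumption)+
  moreover have "x - y \<in> I" if rel: "lpa_relation E lab B x y" for x y
  proof -
    obtain d where "homogeneous d (x - y)" using lpa_relation_homogeneous[OF rel] by blast
    then show ?thesis
      using lpa_ideal_relator[OF rel] lpa_ideal_zero by (auto simp: I_def component_homogeneous)
  qed
  ultimately have "lpa_ideal \<subseteq> I" by (rule lpa_ideal_least)
  then show ?thesis using assms by (auto simp: I_def)
qed

text \<open>
  The preimage of the ideal of relations in the ring of all noncommutative polynomials. The quotient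
  by it is the Leavitt labelled path algebra with a unit adjoined.
\<close>
definition unital_ideal :: "('v, 'a, 'k::field) lpa_free set" where
  "unital_ideal = {x. retract x \<in> lpa_ideal}"

lemma unital_ideal_component: "x \<in> unital_ideal \<Longrightarrow> component d x \<in> unital_ideal"
  using lpa_ideal_component[of "retract x" d]
  by (simp add: unital_ideal_def retract_def component_def
      restrict_keys_commute[of "{w. set (letters w) \<subseteq> G}"])

lemma unital_ideal_carrier:
  "x \<in> carrier (free_algebra G) \<Longrightarrow> x \<in> unital_ideal \<longleftrightarrow> x \<in> lpa_ideal"
  by (simp add: unital_ideal_def retract_carrier)

lemma congruence_ideal_unital_ideal:
  "congruence_ideal (unital_ideal :: ('v, 'a, 'k::field) lpa_free set)"
proof
  show "(0 :: ('v, 'a, 'k) lpa_free) \<in> unital_ideal"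
    by (simp add: unital_ideal_def retract_def lpa_ideal_zero)
  show "x + y \<in> unital_ideal" if "x \<in> unital_ideal" "y \<in> unital_ideal" for x y :: "('v, 'a, 'k) lpa_free"
    using that by (simp add: unital_ideal_def retract_def restrict_keys_add lpa_ideal_add)
  show "z * x \<in> unital_ideal" "x * z \<in> unital_ideal"
    if "x \<in> unital_ideal" for x z :: "('v, 'a, 'k) lpa_free"
    using that by (simp_all add: unital_ideal_def retract_mult lpa_ideal_retract_mult)
qed

sublocale lpa: congruence_ideal "unital_ideal :: ('v, 'a, 'k::field) lpa_free set"
  by (rule congruence_ideal_unital_ideal)

lemma lpa_relation_eqv:
  fixes x y :: "('v, 'a, 'k::field) lpa_free"
  assumes "lpa_relation E lab B x y"
  shows "lpa.eqv x y"
  using lpa_ideal_relator[OF assms] unital_ideal_carrier lpa_ideal_carrier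
  by (auto simp: lpa.eqv_def)

lemma free_gen_eqv_zero: "g \<notin> G \<Longrightarrow> lpa.eqv (free_gen g) 0"
  unfolding lpa.eqv_zero_iff
  by (simp add: unital_ideal_def retract_def free_gen_def restrict_keys_single lpa_ideal_zero)

section \<open>Projections, edges and ghost edges\<close>

definition projections :: "('v, 'a, 'k::field) lpa_free set" where
  "projections = {x. lpa.eqv x 1 \<or> (\<exists>A\<in>B. lpa.eqv x (lpa_p A))}"

text \<open>
  Edges and ghost edges outside the alphabet are congruent to zero, which is the projection of the
  empty set, so that the relations hold for all letters of the type.
\<close>
lemma isometry_algebra_lpa:
  "isometry_algebra (unital_ideal :: ('v, 'a, 'k::field) lpa_free set) projections lpa_s lpa_s_star
    (Poly_Mapping.single 0)"
proof
  note rel = lpa_relation_eqv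
  have r: "rel_range E lab A [a] \<in> B" if "A \<in> B" "a \<in> alphabet E lab" for A a
    using that by (simp add: B_rel_range label_words_def label_in_label_words1)
  have wr: "word_range E lab [a] \<in> B" if "a \<in> alphabet E lab" for a
    using that by (simp add: B_word_range label_in_label_words1)
  have out: "lpa.eqv (lpa_s a :: ('v, 'a, 'k) lpa_free) 0" "lpa.eqv (lpa_s_star a :: ('v, 'a, 'k) lpa_free) 0"
    if "a \<notin> alphabet E lab" for a
    using that by (auto intro!: free_gen_eqv_zero simp: lpa_generators_def)
  have zero_left: "lpa.eqv (x * y) 0" and zero_right: "lpa.eqv (y * x) 0"
    if "lpa.eqv x 0" for x y :: "('v, 'a, 'k) lpa_free"
    using lpa.eqv_mult_right[OF that] lpa.eqv_mult_left[OF that] by simp_all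
  show one: "1 \<in> (projections :: ('v, 'a, 'k) lpa_free set)"
    by (simp add: projections_def)
  have eqv: "q \<in> projections" if "p \<in> projections" "lpa.eqv p q" for p q :: "('v, 'a, 'k) lpa_free"
    using that lpa.eqv_trans[OF lpa.eqv_sym] unfolding projections_def by blast
  have PI: "lpa_p A \<in> (projections :: ('v, 'a, 'k) lpa_free set)" if "A \<in> B" for A
    using that by (auto simp: projections_def)
  have PE: "thesis" if "p \<in> projections" "lpa.eqv p 1 \<Longrightarrow> thesis"
    "\<And>A. A \<in> B \<Longrightarrow> lpa.eqv p (lpa_p A) \<Longrightarrow> thesis" for p :: "('v, 'a, 'k) lpa_free" and thesis
    using that by (auto simp: projections_def)
  have Int: "lpa.eqv (lpa_p A * lpa_p C :: ('v, 'a, 'k) lpa_free) (lpa_p (A \<inter> C))" if "A \<in> B" "C \<in> B" for A C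
    using lpa.eqv_sym[OF rel[OF p_Int[OF that]]] .
  have mult: "lpa.eqv (p * q) (lpa_p (A \<inter> C))"
    if "A \<in> B" "lpa.eqv p (lpa_p A)" "C \<in> B" "lpa.eqv q (lpa_p C)"
    for A C and p q :: "('v, 'a, 'k) lpa_free"
    using lpa.eqv_trans[OF lpa.eqv_mult Int] that by blast
  show "p * q \<in> projections" if p: "p \<in> projections" and q: "q \<in> projections"
    for p q :: "('v, 'a, 'k) lpa_free"
  proof (rule PE[OF p])
    assume "lpa.eqv p 1"
    then have "lpa.eqv q (p * q)" using lpa.eqv_sym[OF lpa.eqv_mult_right[of p 1 q]] by simp
    then show ?thesis by (rule eqv[OF q])
  next
    fix A assume A: "A \<in> B" "lpa.eqv p (lpa_p A)"
    show ?thesis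
    proof (rule PE[OF q])
      assume "lpa.eqv q 1"
      then have "lpa.eqv p (p * q)" using lpa.eqv_sym[OF lpa.eqv_mult_left[of q 1 p]] by simp
      then show ?thesis by (rule eqv[OF p])
    next
      fix C assume C: "C \<in> B" "lpa.eqv q (lpa_p C)"
      show ?thesis using eqv[OF PI lpa.eqv_sym[OF mult[OF A C]]] A(1) C(1) B_Int by blast
    qed
  qed
  show "lpa.eqv (p * q) (q * p)" if p: "p \<in> projections" and q: "q \<in> projections"
    for p q :: "('v, 'a, 'k) lpa_free"
  proof (rule PE[OF p])
    assume "lpa.eqv p 1"
    then have "lpa.eqv (p * q) q" "lpa.eqv (q * p) q"
      using lpa.eqv_mult_right[of p 1 q] lpa.eqv_mult_left[of p 1 q] by simp_all
    then show ?thesis using lpa.eqv_trans[OF _ lpa.eqv_sym] by blast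
  next
    fix A assume A: "A \<in> B" "lpa.eqv p (lpa_p A)"
    show ?thesis
    proof (rule PE[OF q])
      assume "lpa.eqv q 1"
      then have "lpa.eqv (p * q) p" "lpa.eqv (q * p) p"
        using lpa.eqv_mult_right[of q 1 p] lpa.eqv_mult_left[of q 1 p] by simp_all
      then show ?thesis using lpa.eqv_trans[OF _ lpa.eqv_sym] by blast
    next
      fix C assume C: "C \<in> B" "lpa.eqv q (lpa_p C)"
      show ?thesis
        using lpa.eqv_trans[OF mult[OF A C] lpa.eqv_sym[OF mult[OF C A, unfolded Int_commute[of C A]]]] .
    qed
  qed
  show "lpa.eqv (p * p) p" if p: "p \<in> projections" for p :: "('v, 'a, 'k) lpa_free"
  proof (rule PE[OF p])
    assume "lpa.eqv p 1"
    then show ?thesis using lpa.eqv_mult_right[of p 1 p] by simp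
  next
    fix A assume A: "A \<in> B" "lpa.eqv p (lpa_p A)"
    show ?thesis using lpa.eqv_trans[OF mult[OF A A] lpa.eqv_sym] A by simp
  qed
  show "\<exists>q\<in>projections. lpa.eqv (p * lpa_s a) (lpa_s a * q) \<and> lpa.eqv (lpa_s_star a * p) (q * lpa_s_star a)"
    if p: "p \<in> projections" for p :: "('v, 'a, 'k) lpa_free" and a
  proof (rule PE[OF p])
    assume "lpa.eqv p 1"
    then show ?thesis
      using lpa.eqv_mult_right[of p 1 "lpa_s a"] lpa.eqv_mult_left[of p 1 "lpa_s_star a"] one
      by (intro bexI[of _ 1]) simp_all
  next
    fix A assume A: "A \<in> B" "lpa.eqv p (lpa_p A)"
    show ?thesis
    proof (cases "a \<in> alphabet E lab")
      case True
      then show ?thesis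
        using PI[OF r[OF A(1) True]]
          lpa.eqv_trans[OF lpa.eqv_mult_right[OF A(2)] rel[OF p_s[OF A(1) True]]]
          lpa.eqv_trans[OF lpa.eqv_mult_left[OF A(2)] rel[OF s_star_p[OF A(1) True]]]
        by blast
    next
      case False
      then show ?thesis
        using one lpa.eqv_trans[OF zero_right[OF out(1)] lpa.eqv_sym[OF zero_left[OF out(1)]]]
          lpa.eqv_trans[OF zero_left[OF out(2)] lpa.eqv_sym[OF zero_right[OF out(2)]]] by blast
    qed
  qed
  show "lpa_s_star a * lpa_s a \<in> (projections :: ('v, 'a, 'k) lpa_free set)" for a
  proof (cases "a \<in> alphabet E lab")
    case True
    then show ?thesis using rel[OF s_star_s[OF True]] wr unfolding projections_def by blast
  next
    case False
    have "lpa.eqv (lpa_s_star a * lpa_s a :: ('v, 'a, 'k) lpa_free) (lpa_p {})"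
      by (rule lpa.eqv_trans[OF zero_right[OF out(1)[OF False]] lpa.eqv_sym[OF rel[OF p_empty]]])
    then show ?thesis using empty_in_B unfolding projections_def by blast
  qed
  show "lpa.eqv (lpa_s_star a * lpa_s b :: ('v, 'a, 'k) lpa_free) 0" if "a \<noteq> b" for a b
    using rel[OF s_star_s_neq[of b E lab a]] that zero_right[OF out(1)] zero_left[OF out(2)] by blast
  show "lpa.eqv (lpa_s a * lpa_s_star a * lpa_s a) (lpa_s a :: ('v, 'a, 'k) lpa_free)" for a
    using rel[OF s_s_star_s[of a E lab]] lpa.eqv_trans[OF zero_right[OF out(1)] lpa.eqv_sym[OF out(1)]] by blast
  show "lpa.eqv (lpa_s_star a * lpa_s a * lpa_s_star a) (lpa_s_star a :: ('v, 'a, 'k) lpa_free)" for a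
    using rel[OF s_star_s_s_star[of a E lab]] lpa.eqv_trans[OF zero_right[OF out(2)] lpa.eqv_sym[OF out(2)]] by blast
  show "Poly_Mapping.single 0 c * x = x * Poly_Mapping.single 0 c" for c and x :: "('v, 'a, 'k) lpa_free"
    by (rule single_zero_central[symmetric])
qed (simp_all add: single_add mult_single)

sublocale lpa: isometry_algebra "unital_ideal :: ('v, 'a, 'k::field) lpa_free set" projections
  lpa_s lpa_s_star "Poly_Mapping.single 0"
  by (rule isometry_algebra_lpa)

lemma single_in_monomials:
  "\<exists>m. (Poly_Mapping.single (Word l) c :: ('v, 'a, 'k::field) lpa_free) \<in> lpa.monomials m (word_degree (Word l))"
proof (induction l rule: rev_induct)
  case Nil
  have "(Poly_Mapping.single 0 c :: ('v, 'a, 'k) lpa_free) \<in> lpa.diag"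
    using lpa.diag_scale[OF lpa.P_one] by simp
  then have "(Poly_Mapping.single 0 c :: ('v, 'a, 'k) lpa_free) \<in> lpa.monomials 0 0"
    by (simp add: lpa.graded_span_def)
  then show ?case by (auto simp: zero_free_word_def word_degree_def simp del: lpa.monomials.simps)
next
  case (snoc g l)
  let ?x = "Poly_Mapping.single (Word l) c :: ('v, 'a, 'k) lpa_free"
  obtain m where m: "?x \<in> lpa.monomials m (word_degree (Word l))" using snoc by blast
  have eq: "Poly_Mapping.single (Word (l @ [g])) c = ?x * free_gen g"
    by (simp add: free_gen_def mult_single plus_free_word_def)
  have deg: "word_degree (Word (l @ [g])) = word_degree (Word l) + letter_degree g"
    by (simp add: word_degree_def)
  show ?case
  proof (cases g)
    case (Proj A)
    show ?thesis
    proof (cases "A \<in> B")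
      case True
      then have "lpa_p A \<in> (projections :: ('v, 'a, 'k) lpa_free set)" by (auto simp: projections_def)
      from lpa.monomials_mult_P[OF m this] show ?thesis
        unfolding eq deg using Proj by (intro exI[of _ m]) simp
    next
      case False
      then have "lpa.eqv (free_gen g :: ('v, 'a, 'k) lpa_free) 0"
        using Proj by (intro free_gen_eqv_zero) (auto simp: lpa_generators_def)
      then have "lpa.eqv 0 (?x * free_gen g)"
        using lpa.eqv_sym[OF lpa.eqv_mult_left[of "free_gen g" 0 ?x]] by simp
      from lpa.monomials_eqv[OF lpa.monomials_zero this] show ?thesis unfolding eq by blast
    qed
  next
    case (Edge a)
    show ?thesis unfolding eq deg using lpa.monomials_mult_s[OF m, of a] Edge by (intro exI[of _ m]) simp
  next
    case (Ghost a)
    have "?x * free_gen g \<in> lpa.monomials (Suc m) (word_degree (Word l) + letter_degree g)"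
      using lpa.monomials_mult_t[OF m, of a] unfolding Ghost letter_degree.simps add_uminus_conv_diff .
    then show ?thesis unfolding eq deg by blast
  qed
qed

lemma component_in_monomials: "\<exists>m. component d (x :: ('v, 'a, 'k::field) lpa_free) \<in> lpa.monomials m d"
proof (induction x rule: poly_mapping_additive_induct)
  case zero
  then show ?case unfolding component_zero using lpa.monomials_zero by blast
next
  case (add w c x)
  obtain m where m: "component d x \<in> lpa.monomials m d" using add by blast
  obtain n where n: "component d (Poly_Mapping.single w c :: ('v, 'a, 'k) lpa_free) \<in> lpa.monomials n d"
  proof (cases "word_degree w = d")
    case True
    then have "component d (Poly_Mapping.single w c) = Poly_Mapping.single w c"
      by (simp add: component_def restrict_keys_single)
    moreover obtain n where "(Poly_Mapping.single w c :: ('v, 'a, 'k) lpa_free) \<in> lpa.monomials n d"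
      using single_in_monomials[of "letters w" c] unfolding free_word.collapse True by blast
    ultimately show ?thesis by (intro that[of n]) simp
  next
    case False
    then have "component d (Poly_Mapping.single w c) = 0"
      by (simp add: component_def restrict_keys_single)
    with lpa.monomials_zero[of 0 d] show ?thesis by (intro that[of 0]) (simp only:)
  qed
  have "component d (Poly_Mapping.single w c) + component d x \<in> lpa.monomials (max m n) d"
    by (rule lpa.monomials_add[OF lpa.monomials_mono[OF max.cobounded2 n] lpa.monomials_mono[OF max.cobounded1 m]])
  then show ?case unfolding component_add by blast
qed

section \<open>Reduction to the leading component\<close>

lemma leading_component:
  fixes x :: "('v, 'a, 'k::field) lpa_free"
  assumes "x \<notin> unital_ideal"
  obtains d where "restrict_keys {w. word_degree w > d} x \<in> unital_ideal" "component d x \<notin> unital_ideal"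
proof -
  define hi where "hi d = restrict_keys {w. word_degree w > d} x" for d
  \<comment> \<open>Including \<open>0\<close> keeps the set nonempty for \<open>x = 0\<close> and makes the bound nonnegative.\<close>
  define N where "N = Max (insert 0 ((\<lambda>w. \<bar>word_degree w\<bar>) ` Poly_Mapping.keys x))"
  have N: "\<bar>word_degree w\<bar> \<le> N" if "w \<in> Poly_Mapping.keys x" for w
    unfolding N_def using that by (intro Max_ge) auto
  have top: "hi N = 0"
    unfolding hi_def using N by (intro restrict_keys_eq_zero) force
  have bot: "hi (- N - 1) = x"
    unfolding hi_def using N by (intro restrict_keys_id) force
  have step: "hi (d - 1) = component d x + hi d" for d
    unfolding hi_def component_def
    by (rule poly_mapping_eqI) (auto simp: lookup_restrict_keys lookup_add when_def)
  have "0 \<le> N" unfolding N_def by (rule Max_ge) auto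
  have "\<exists>d. hi d \<in> unital_ideal \<and> hi (d - 1) \<notin> unital_ideal"
  proof (rule ccontr)
    assume *: "\<not> ?thesis"
    have "hi (N - int n) \<in> unital_ideal" for n
    proof (induction n)
      case (Suc n)
      then show ?case using * by (auto simp: algebra_simps)
    qed (simp add: top lpa.zero_mem)
    from this[of "nat (2 * N + 1)"] show False using assms bot \<open>0 \<le> N\<close> by simp
  qed
  then show thesis using that step lpa.add_mem unfolding hi_def by metis
qed

text \<open>
  With \<open>h\<close> the leading component of \<open>x\<close> and \<open>d\<close> its degree, some monomial \<open>z\<close> satisfies \<open>h z h \<noteq> 0\<close>. Modulo the ideal,
  \<open>x\<close> has no components of degree above \<open>d\<close>, so \<open>h z h\<close> is the component of \<open>x z x\<close> in degree
  \<open>2 d + deg z\<close>.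
\<close>
lemma unital_ideal_semiprime:
  fixes x :: "('v, 'a, 'k::field) lpa_free"
  assumes "x \<notin> unital_ideal"
  shows "\<exists>y. x * y * x \<notin> unital_ideal"
proof -
  obtain d where hi: "restrict_keys {w. word_degree w > d} x \<in> unital_ideal" (is "?hi \<in> _")
    and lead: "component d x \<notin> unital_ideal"
    using leading_component[OF assms] by blast
  define lo where "lo = restrict_keys {w. word_degree w < d} x"
  define h where "h = component d x"
  have x: "x - (h + lo) = ?hi"
    unfolding h_def lo_def component_def
    by (rule poly_mapping_eqI) (auto simp: lookup_restrict_keys lookup_add lookup_minus when_def)
  obtain m where "h \<in> lpa.monomials m d" unfolding h_def using component_in_monomials by blast
  then obtain y where y: "h * y * h \<notin> unital_ideal"
    using lpa.monomials_nondegenerate[of h m d] lead by (auto simp: lpa.eqv_zero_iff h_def)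
  have "\<exists>w c. h * Poly_Mapping.single w c * h \<notin> unital_ideal"
  proof (rule ccontr)
    assume *: "\<not> ?thesis"
    have "h * y * h \<in> unital_ideal"
    proof (induction y rule: poly_mapping_additive_induct)
      case (add w c y)
      then show ?case
        unfolding distrib_left distrib_right using * by (blast intro: lpa.add_mem)
    qed (simp add: lpa.zero_mem)
    then show False using y by blast
  qed
  then obtain w c where wc: "h * Poly_Mapping.single w c * h \<notin> unital_ideal" by blast
  define z where "z = (Poly_Mapping.single w c :: ('v, 'a, 'k) lpa_free)"
  define e where "e = word_degree w"
  have "x * z * x \<notin> unital_ideal"
  proof
    assume xzx: "x * z * x \<in> unital_ideal"
    have "lpa.eqv x (h + lo)" using hi by (simp add: lpa.eqv_def x)
    then have "lpa.eqv (x * z * x) ((h + lo) * z * (h + lo))"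
      by (intro lpa.eqv_mult lpa.eqv_refl)
    from lpa.eqv_trans[OF lpa.eqv_sym[OF this]] xzx have "(h + lo) * z * (h + lo) \<in> unital_ideal"
      unfolding lpa.eqv_zero_iff[symmetric] by blast
    then have 1: "component (d + e + d) ((h + lo) * z * (h + lo)) \<in> unital_ideal"
      by (rule unital_ideal_component)
    have kh: "Poly_Mapping.keys h \<subseteq> {w. word_degree w \<le> d}"
      and kl: "Poly_Mapping.keys lo \<subseteq> {w. word_degree w \<le> d - 1}"
      and kz: "Poly_Mapping.keys z \<subseteq> {w. word_degree w \<le> e}"
      and khl: "Poly_Mapping.keys (h + lo) \<subseteq> {w. word_degree w \<le> d}"
      using keys_add[of h lo] by (auto simp: h_def lo_def component_def z_def e_def)
    have low: "component (d + e + d) f = 0"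
      if "Poly_Mapping.keys f \<subseteq> {w. word_degree w \<le> d + e + (d - 1)}" for f :: "('v, 'a, 'k) lpa_free"
      unfolding component_def using that by (intro restrict_keys_eq_zero) force
    have l1: "component (d + e + d) (lo * z * (h + lo)) = 0"
      using keys_mult_degree_le[OF keys_mult_degree_le[OF kl kz] khl] by (intro low) (simp add: algebra_simps)
    have l2: "component (d + e + d) (h * z * lo) = 0"
      using keys_mult_degree_le[OF keys_mult_degree_le[OF kh kz] kl] by (rule low)
    have "homogeneous d h" "homogeneous e z"
      by (auto simp: homogeneous_def h_def component_def z_def e_def)
    then have "homogeneous (d + e + d) (h * z * h)" by (intro homogeneous_mult)
    then have l3: "component (d + e + d) (h * z * h) = h * z * h" by (simp add: component_homogeneous)
    have "(h + lo) * z * (h + lo) = h * z * h + h * z * lo + lo * z * (h + lo)"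
      by (simp add: algebra_simps)
    then have "component (d + e + d) ((h + lo) * z * (h + lo)) = h * z * h"
      by (simp only: component_add l1 l2 l3) simp
    then show False using 1 wc by (simp add: z_def)
  qed
  then show ?thesis by blast
qed

text \<open>
  The middle factor \<open>y\<close> supplied by \<open>unital_ideal_semiprime\<close> may have a constant term. Applying that
  result again to \<open>x y x\<close> gives \<open>x (y x y' x y) x \<noteq> 0\<close>, whose middle factor contains \<open>x\<close> and so has
  none.
\<close>
lemma lpa_ideal_semiprime:
  fixes x :: "('v, 'a, 'k::field) lpa_free"
  assumes x: "x \<in> carrier (free_algebra G)" "x \<notin> lpa_ideal"
  shows "\<exists>z\<in>carrier (free_algebra G). x * z * x \<notin> lpa_ideal"
proof -
  have "x \<notin> unital_ideal" using assms by (simp add: unital_ideal_carrier)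
  then obtain y where y: "x * y * x \<notin> unital_ideal" using unital_ideal_semiprime by blast
  then obtain y' where y': "x * y * x * y' * (x * y * x) \<notin> unital_ideal"
    using unital_ideal_semiprime by blast
  define z where "z = retract (y * x * y' * x * y)"
  have z: "z \<in> carrier (free_algebra G)"
  proof -
    have "letters w \<noteq> []" if "w \<in> Poly_Mapping.keys (y * x * y' * x * y)" for w
    proof -
      have "w \<in> Poly_Mapping.keys (y * x * (y' * x * y))"
        using that by (simp add: mult.assoc)
      then obtain a b where "w = a + b" "a \<in> Poly_Mapping.keys (y * x)"
        using keys_mult[of "y * x" "y' * x * y"] by blast
      moreover obtain a1 a2 where "a = a1 + a2" "a2 \<in> Poly_Mapping.keys x"
        using calculation(2) keys_mult[of y x] by blast
      ultimately show ?thesis using x(1) by (auto simp: free_algebra_def plus_free_word_def)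
    qed
    then show ?thesis by (auto simp: z_def retract_def free_algebra_def)
  qed
  have "retract (x * y * x * y' * (x * y * x)) = x * z * x"
    by (simp add: retract_mult z_def retract_carrier[OF x(1)] mult.assoc)
  then have "x * z * x \<notin> lpa_ideal" using y' by (simp add: unital_ideal_def)
  then show ?thesis using z by blast
qed

end

section \<open>Semiprimeness\<close>

theorem theorem4p4:
  fixes E :: "('v, 'e) pre_digraph"
    and lab :: "'e \<Rightarrow> 'a"
    and B :: "'v set set"
  assumes "normal_labelled_space E lab B"
  shows "semiprime_ring
    (leavitt_labelled_path_algebra E lab B :: ('k::field, ('v, 'a, 'k) lpa_free set) module)"
proof -
  interpret normal_labelled_space E lab B by (rule assms)
  let ?F = "free_algebra G :: ('k, ('v, 'a, 'k) lpa_free) module"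
  let ?J = "lpa_ideal :: ('v, 'a, 'k) lpa_free set"
  define L where "L = (leavitt_labelled_path_algebra E lab B :: ('k, ('v, 'a, 'k) lpa_free set) module)"
  have L: "L = quotient_algebra ?F ?J"
    by (simp add: L_def leavitt_labelled_path_algebra_def lpa_ideal_def Let_def)
  interpret L: nonunital_algebra L
    unfolding L_def by (rule leavitt_labelled_path_algebra_nonunital_algebra)
  interpret J: algebra_ideal ?J ?F by (rule lpa_ideal_algebra_ideal)
  interpret Jab: abelian_subgroup ?J ?F by (rule J.abelian_subgroup)
  have sel: "carrier L = carrier (?F Quot ?J)" "mult L = mult (?F Quot ?J)" "zero L = zero (?F Quot ?J)"
    by (simp_all add: L quotient_algebra_def ring.defs module.defs)
  have carr: "carrier L = {?J +>\<^bsub>?F\<^esub> x | x. x \<in> carrier ?F}"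
    by (auto simp: sel FactRing_simps)
  have zero: "zero L = ?J" by (simp add: sel FactRing_simps)
  have Fmult: "mult ?F = (*)" by (simp add: free_algebra_def)
  have mult: "(?J +>\<^bsub>?F\<^esub> x) \<otimes>\<^bsub>L\<^esub> (?J +>\<^bsub>?F\<^esub> y) = ?J +>\<^bsub>?F\<^esub> (x * y)"
    if "x \<in> carrier ?F" "y \<in> carrier ?F" for x y
    using J.rcoset_mult_add[OF that] by (simp add: sel FactRing_simps Fmult)
  have Fclosed: "x * y \<in> carrier ?F" if "x \<in> carrier ?F" "y \<in> carrier ?F" for x y
    using J.m_closed[OF that] by (simp add: Fmult)
  have coset_zero: "?J +>\<^bsub>?F\<^esub> x = ?J \<longleftrightarrow> x \<in> ?J" if "x \<in> carrier ?F" for x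
    using Jab.a_rcos_const Jab.a_rcos_self[OF that] by auto
  have "I = {\<zero>\<^bsub>L\<^esub>}" if I: "ring_ideal I L" and sq: "ideal_prod L I I = {\<zero>\<^bsub>L\<^esub>}" for I
  proof -
    interpret I: ring_ideal I L by (rule I)
    have "X = \<zero>\<^bsub>L\<^esub>" if X: "X \<in> I" for X
    proof -
      obtain x where x: "x \<in> carrier ?F" "X = ?J +>\<^bsub>?F\<^esub> x"
        using I.a_Hcarr[OF X] unfolding carr by blast
      have "x * z * x \<in> ?J" if z: "z \<in> carrier ?F" for z
      proof -
        have "?J +>\<^bsub>?F\<^esub> z \<in> carrier L" using z by (auto simp: carr)
        then have "(X \<otimes>\<^bsub>L\<^esub> (?J +>\<^bsub>?F\<^esub> z)) \<otimes>\<^bsub>L\<^esub> X \<in> ideal_prod L I I"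
          using X by (intro ideal_prod.prod I.I_r_closed)
        then have "?J +>\<^bsub>?F\<^esub> (x * z * x) = ?J"
          using x z by (simp add: mult Fclosed sq zero)
        then show ?thesis using x z by (simp add: coset_zero Fclosed)
      qed
      then have "x \<in> ?J" using lpa_ideal_semiprime[OF x(1)] by blast
      then show ?thesis using x coset_zero zero by simp
    qed
    then show ?thesis using I.zero_closed by auto
  qed
  then show ?thesis
    unfolding L_def[symmetric]
    by (intro semiprime_ring.intro semiprime_ring_axioms.intro L.nonunital_ring_axioms)
qed

end
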